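(* Let $0<R_1<R_2$, let $\Omega:=\{x\in\mathbb{R}^2: R_1<|x|<R_2\}$, and let $\Gamma_i:=\{x\in\mathbb{R}^2:|x|=R_i\}$, $i=1,2$. Let $v_*\in W^{1/2,2}(\partial\Omega)$ be a vector field with values in $\mathbb{R}^2$ such that $$\Phi:=\int_{\Gamma_2}v_*\cdot n=-\int_{\Gamma_1}v_*\cdot n,$$ where $n$ is the unit outer normal to $\partial\Omega$. If $\Phi>0$, then the Leray--Hopf Extension Condition does not hold for $v_*$.
   Context: Leray--Hopf Extension Condition for $v_*$: for every $\varepsilon>0$ there exists a solenoidal (i.e. divergence-free) vector field $V_\varepsilon\in W^{1,2}(\Omega)$ with values in $\mathbb{R}^2$, which is an extension of $v_*$ (i.e. $V_\varepsilon=v_*$ on $\partial\Omega$ in the trace sense), such that $$-(u\cdot\nabla V_\varepsilon,u)\le \varepsilon\,\|\nabla u\|_2^2$$ for all solenoidal vector fields $u\in W^{1,2}_0(\Omega)$ with values in $\mathbb{R}^2$. Notation: $(a,b)=\int_\Omega a_ib_i$ (summation over repeated indices), so that $(u\cdot\nabla V,u)=\int_\Omega u_j\,(\partial_jV_i)\,u_i$; $\|\cdot\|_2$ is the $L^2(\Omega)$-norm. $W^{1,2}(\Omega)$, $W^{1,2}_0(\Omega)$ and $W^{1/2,2}(\partial\Omega)$ are the usual Sobolev and trace spaces. *)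

theory Defs
  imports "HOL-Analysis.Analysis"
begin

definition square_integrable :: "'a measure \<Rightarrow> ('a \<Rightarrow> 'b::euclidean_space) \<Rightarrow> bool" where
  "square_integrable M f \<longleftrightarrow> f \<in> borel_measurable M \<and> integrable M (\<lambda>x. (norm (f x))\<^sup>2)"

definition l2_norm :: "'a measure \<Rightarrow> ('a \<Rightarrow> 'b::euclidean_space) \<Rightarrow> real" where
  "l2_norm M f = sqrt (\<integral>x. (norm (f x))\<^sup>2 \<partial>M)"

primrec C_k :: "nat \<Rightarrow> ('a::euclidean_space \<Rightarrow> 'b::euclidean_space) \<Rightarrow> bool" where
  "C_k 0 f \<longleftrightarrow> continuous_on UNIV f"
| "C_k (Suc k) f \<longleftrightarrow> (\<forall>x. f differentiable (at x)) \<and>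
     (\<forall>b\<in>Basis. C_k k (\<lambda>x. frechet_derivative f (at x) b))"

definition smooth :: "('a::euclidean_space \<Rightarrow> 'b::euclidean_space) \<Rightarrow> bool" where
  "smooth f \<longleftrightarrow> (\<forall>k. C_k k f)"

definition test_functions :: "'a::euclidean_space set \<Rightarrow> ('a \<Rightarrow> 'b::euclidean_space) set" where
  "test_functions \<Omega> = {\<phi>. smooth \<phi> \<and> compact (closure {x. \<phi> x \<noteq> 0}) \<and> closure {x. \<phi> x \<noteq> 0} \<subseteq> \<Omega>}"

text \<open>
  Fields are total functions of which only the values on \<open>\<Omega>\<close> matter, and they are not
  quotiented by equality almost everywhere. The weak Jacobian \<open>G\<close> has the entries
  \<open>G x $ i $ j\<close>, the weak partial derivative in direction \<open>j\<close> of component \<open>i\<close>; the norm of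
  \<^typ>\<open>real ^ 'n ^ 'm\<close> is the Frobenius norm.
\<close>

definition has_weak_grad ::
  "(real ^ 'n) set \<Rightarrow> (real ^ 'n \<Rightarrow> real ^ 'm) \<Rightarrow> (real ^ 'n \<Rightarrow> real ^ 'n ^ 'm) \<Rightarrow> bool" where
  "has_weak_grad \<Omega> f G \<longleftrightarrow>
     square_integrable (lebesgue_on \<Omega>) f \<and> square_integrable (lebesgue_on \<Omega>) G \<and>
     (\<forall>\<phi> :: real ^ 'n \<Rightarrow> real. \<phi> \<in> test_functions \<Omega> \<longrightarrow> (\<forall>i j.
        (\<integral>x. f x $ i * frechet_derivative \<phi> (at x) (axis j 1) \<partial>lebesgue_on \<Omega>) =
        - (\<integral>x. G x $ i $ j * \<phi> x \<partial>lebesgue_on \<Omega>)))"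

definition W12 :: "(real ^ 'n) set \<Rightarrow> (real ^ 'n \<Rightarrow> real ^ 'm) set" where
  "W12 \<Omega> = {f. \<exists>G. has_weak_grad \<Omega> f G}"

text \<open>The weak Jacobian of a field in \<open>W12 \<Omega>\<close> is determined almost everywhere on \<open>\<Omega>\<close>.\<close>

definition weak_grad ::
  "(real ^ 'n) set \<Rightarrow> (real ^ 'n \<Rightarrow> real ^ 'm) \<Rightarrow> real ^ 'n \<Rightarrow> real ^ 'n ^ 'm" where
  "weak_grad \<Omega> f = (SOME G. has_weak_grad \<Omega> f G)"

definition W12_norm :: "(real ^ 'n) set \<Rightarrow> (real ^ 'n \<Rightarrow> real ^ 'm) \<Rightarrow> real" where
  "W12_norm \<Omega> f =
     sqrt ((l2_norm (lebesgue_on \<Omega>) f)\<^sup>2 + (l2_norm (lebesgue_on \<Omega>) (weak_grad \<Omega> f))\<^sup>2)"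

definition W12_0 :: "(real ^ 'n) set \<Rightarrow> (real ^ 'n \<Rightarrow> real ^ 'm) set" where
  "W12_0 \<Omega> = {u \<in> W12 \<Omega>. \<exists>\<phi> :: nat \<Rightarrow> real ^ 'n \<Rightarrow> real ^ 'm.
     (\<forall>k. \<phi> k \<in> test_functions \<Omega>) \<and> (\<lambda>k. W12_norm \<Omega> (\<lambda>x. \<phi> k x - u x)) \<longlonglongrightarrow> 0}"

definition solenoidal :: "(real ^ 'n) set \<Rightarrow> (real ^ 'n \<Rightarrow> real ^ 'n) \<Rightarrow> bool" where
  "solenoidal \<Omega> f \<longleftrightarrow> (AE x in lebesgue_on \<Omega>. (\<Sum>i\<in>UNIV. weak_grad \<Omega> f x $ i $ i) = 0)"

text \<open>\<open>convective_form \<Omega> u V w\<close> is \<open>(u \<cdot> \<nabla>V, w)\<close>.\<close>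

definition convective_form ::
  "(real ^ 'n) set \<Rightarrow> (real ^ 'n \<Rightarrow> real ^ 'n) \<Rightarrow> (real ^ 'n \<Rightarrow> real ^ 'n) \<Rightarrow> (real ^ 'n \<Rightarrow> real ^ 'n) \<Rightarrow> real"
  where "convective_form \<Omega> u V w =
     (\<integral>x. (\<Sum>i\<in>UNIV. \<Sum>j\<in>UNIV. u x $ j * weak_grad \<Omega> V x $ i $ j * w x $ i) \<partial>lebesgue_on \<Omega>)"

definition annulus :: "real \<Rightarrow> real \<Rightarrow> (real ^ 2) set" where
  "annulus R1 R2 = {x. R1 < norm x \<and> norm x < R2}"

text \<open>Arc length on the circle \<open>sphere 0 r\<close>, where \<open>r > 0\<close>; its space is the circle itself.\<close>

definition circle_point :: "real \<Rightarrow> real \<Rightarrow> real ^ 2" where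
  "circle_point r t = vector [r * cos t, r * sin t]"

definition circle_measure :: "real \<Rightarrow> (real ^ 2) measure" where
  "circle_measure r =
     embed_measure (density (lebesgue_on {0..<2 * pi}) (\<lambda>_. ennreal r)) (circle_point r)"

text \<open>Only the values on the boundary of \<open>annulus R1 R2\<close> are meaningful.\<close>

definition outer_normal :: "real \<Rightarrow> real \<Rightarrow> real ^ 2 \<Rightarrow> real ^ 2" where
  "outer_normal R1 R2 x = (if norm x = R2 then x /\<^sub>R norm x else - (x /\<^sub>R norm x))"

text \<open>
  The Sobolev--Slobodeckij space of order 1/2 on the boundary. The boundary is one-dimensional,
  so the kernel is \<open>|x - y|\<close> to the power \<open>-(1 + 2 * (1/2)) = -2\<close>. The double integral over the
  boundary is split into its four pieces.
\<close>

definition W_half_boundary :: "real \<Rightarrow> real \<Rightarrow> (real ^ 2 \<Rightarrow> real ^ 2) set" where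
  "W_half_boundary R1 R2 = {v.
     (\<forall>r\<in>{R1, R2}. square_integrable (circle_measure r) v) \<and>
     (\<forall>r\<in>{R1, R2}. \<forall>s\<in>{R1, R2}.
        (\<integral>\<^sup>+x. (\<integral>\<^sup>+y. ennreal ((norm (v x - v y))\<^sup>2 / (norm (x - y))\<^sup>2)
           \<partial>circle_measure s) \<partial>circle_measure r) < \<infinity>)}"

text \<open>
  The trace operator is the continuous extension of the restriction to the boundary from the
  fields smooth up to the boundary, which are dense in \<open>W12\<close>, with values in the
  square-integrable fields on the boundary; \<open>has_trace\<close> is the graph of this operator.
\<close>

definition has_trace :: "real \<Rightarrow> real \<Rightarrow> (real ^ 2 \<Rightarrow> real ^ 2) \<Rightarrow> (real ^ 2 \<Rightarrow> real ^ 2) \<Rightarrow> bool" where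
  "has_trace R1 R2 V v \<longleftrightarrow>
     V \<in> W12 (annulus R1 R2) \<and>
     (\<forall>r\<in>{R1, R2}. square_integrable (circle_measure r) v) \<and>
     (\<exists>w :: nat \<Rightarrow> real ^ 2 \<Rightarrow> real ^ 2.
        (\<forall>k. smooth (w k)) \<and>
        (\<lambda>k. W12_norm (annulus R1 R2) (\<lambda>x. w k x - V x)) \<longlonglongrightarrow> 0 \<and>
        (\<forall>r\<in>{R1, R2}. (\<lambda>k. l2_norm (circle_measure r) (\<lambda>x. w k x - v x)) \<longlonglongrightarrow> 0))"

definition leray_hopf_extension_condition :: "real \<Rightarrow> real \<Rightarrow> (real ^ 2 \<Rightarrow> real ^ 2) \<Rightarrow> bool" where
  "leray_hopf_extension_condition R1 R2 v \<longleftrightarrow>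
     (\<forall>\<epsilon>>0. \<exists>V \<in> W12 (annulus R1 R2).
        solenoidal (annulus R1 R2) V \<and> has_trace R1 R2 V v \<and>
        (\<forall>u \<in> W12_0 (annulus R1 R2). solenoidal (annulus R1 R2) u \<longrightarrow>
           - convective_form (annulus R1 R2) u V u
             \<le> \<epsilon> * (l2_norm (lebesgue_on (annulus R1 R2)) (weak_grad (annulus R1 R2) u))\<^sup>2))"

end

theory Submission
  imports Defs
begin

text \<open>
  Suppose that the condition holds. The idea is to test it with two fields chosen so that the sum
  of the two left-hand sides depends on the extension \<open>V\<close> only through the flux \<open>\<Phi>\<close>. With
  \<open>z = x\<^sub>1 + \<i> x\<^sub>2\<close> let \<open>u\<close> and \<open>u'\<close> be the fields with the stream functions
  \<open>b(|x|\<^sup>2) Re z\<^sup>N\<close> and \<open>b(|x|\<^sup>2) Im z\<^sup>N\<close>, where \<open>b\<close> is a bump. Replacing a field by the sum over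
  this pair is averaging it over rotations: all angular dependence cancels, and
  \<open>u \<otimes> u + u' \<otimes> u' = g(|x|\<^sup>2) x \<otimes> x + \<kappa> I\<close> (\<open>stream_field_products\<close>).

  Since \<open>div V = 0\<close>, the multiple of the identity drops out of the convective terms, and an
  integration by parts turns the rest into \<open>\<integral> V \<cdot> \<nabla>H\<close> for a radial potential \<open>H\<close>, namely
  \<open>H(x) = s g(s) + (1/2) \<integral> g\<close> with \<open>s = |x|\<^sup>2\<close> (\<open>integral_convective_quadratic\<close>,
  \<open>radial_potential\<close>). A solenoidal field has the same flux through all circles, so this
  integral is \<open>\<Phi>\<close> times the increment \<open>c = (1/2) \<integral> g\<close> of \<open>H\<close> across the annulus
  (\<open>integral_radial_gradient\<close>). The condition thus yields \<open>c \<Phi> \<le> \<epsilon> C\<close> for all \<open>\<epsilon> > 0\<close>, where neither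
  \<open>c\<close> nor \<open>C\<close> depends on \<open>V\<close> or \<open>\<epsilon>\<close>; hence \<open>c \<Phi> \<le> 0\<close>.

  It remains to make \<open>c\<close> positive. For \<open>b(s) = s\<^bsup>-N/2\<^esup> e(s)\<close> with a fixed bump \<open>e\<close> one finds
  \<open>g = N\<^sup>2 e\<^sup>2 / s\<^sup>2 - 4 e'\<^sup>2\<close>, whose integral is positive once the angular frequency \<open>N\<close> is large
  (\<open>exists_radial_profile\<close>): rapidly oscillating fields are mostly radial, and an outward flow
  \<open>V\<close> decelerates in the radial direction, which makes \<open>- (u \<cdot> \<nabla>V, u)\<close> positive for them.

  Three general facts carry the analysis: a class of explicit functions closed under
  differentiation, which supplies smooth functions with compact support; the almost everywhere
  uniqueness of weak gradients; and the divergence theorem on the annulus in polar coordinates.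
\<close>

section \<open>Explicit smooth functions\<close>

text \<open>
  The classical smooth function that is flat at the origin, together with its multiples by powers
  of \<open>1 / t\<close>; these multiples occur in its derivatives.
\<close>
definition flat :: "nat \<Rightarrow> real \<Rightarrow> real" where
  "flat j t = (if t > 0 then exp (- (1 / t)) / t ^ j else 0)"

lemma tendsto_flat_0: "(flat j \<longlongrightarrow> 0) (at 0)"
proof -
  have "((\<lambda>t::real. t ^ j / exp t) \<longlongrightarrow> 0) at_top"
    by (rule tendsto_power_div_exp_0)
  moreover have "filterlim (\<lambda>t::real. inverse t) at_top (at_right 0)"
    by (rule filterlim_inverse_at_top_right)
  ultimately have "((\<lambda>t::real. (inverse t) ^ j / exp (inverse t)) \<longlongrightarrow> 0) (at_right 0)"
    by (rule filterlim_compose)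
  moreover have "eventually (\<lambda>t::real. (inverse t) ^ j / exp (inverse t) = flat j t) (at_right 0)"
    by (auto simp: eventually_at_filter flat_def exp_minus field_simps power_inverse)
  ultimately have r: "(flat j \<longlongrightarrow> 0) (at_right 0)"
    by (rule Lim_transform_eventually)
  have "(flat j \<longlongrightarrow> 0) (at_left 0)"
    by (rule Lim_transform_eventually[of "\<lambda>_. 0"]) (auto simp: eventually_at_filter flat_def)
  with r show ?thesis
    by (simp add: filterlim_split_at)
qed

lemma has_real_derivative_flat:
  "(flat j has_real_derivative flat (j + 2) t - j * flat (j + 1) t) (at t)"
proof (cases t "0::real" rule: linorder_cases)
  case less
  have "((\<lambda>_. 0) has_real_derivative 0) (at t)" by simp
  then have "(flat j has_real_derivative 0) (at t)"
    by (rule has_field_derivative_transform_within_open[of _ _ _ "{..<0}"])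
       (use less in \<open>auto simp: flat_def\<close>)
  then show ?thesis using less by (simp add: flat_def)
next
  case equal
  have "((\<lambda>h. (flat j (0 + h) - flat j 0) / h) \<longlongrightarrow> 0) (at 0)"
    by (rule Lim_transform_eventually[OF tendsto_flat_0[of "Suc j"]])
       (auto simp: eventually_at_filter flat_def)
  then show ?thesis using equal by (simp add: DERIV_def flat_def)
next
  case greater
  have "((\<lambda>t. exp (- (1 / t)) / t ^ j) has_real_derivative
      flat (j + 2) t - j * flat (j + 1) t) (at t)"
  proof -
    have Q: "real j * t ^ (j - Suc 0) = real j * t ^ j / t"
      using greater by (cases j) auto
    have "((\<lambda>t. exp (- (1 / t)) / t ^ j) has_real_derivative
        (exp (- (1 / t)) * (1 / (t * t)) * t ^ j - exp (- (1 / t)) * (real j * t ^ (j - Suc 0)))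
          / (t ^ j * t ^ j)) (at t)"
      using greater by (auto intro!: derivative_eq_intros simp: field_simps)
    also have "(exp (- (1 / t)) * (1 / (t * t)) * t ^ j - exp (- (1 / t)) * (real j * t ^ (j - Suc 0)))
          / (t ^ j * t ^ j) = flat (j + 2) t - j * flat (j + 1) t"
      unfolding Q using greater by (simp add: flat_def field_simps power2_eq_square)
    finally show ?thesis .
  qed
  then show ?thesis
    by (rule has_field_derivative_transform_within_open[of _ _ _ "{0<..}"])
       (use greater in \<open>auto simp: flat_def\<close>)
qed

text \<open>
  Smoothness is an iterated condition on partial derivatives, so it is easiest to verify for a
  whole class of functions at once: the class below is closed under partial derivatives, hence all
  its members are smooth. It contains the bumps, polynomials and reciprocals that occur later.
\<close>
inductive_set elementary :: "('a::euclidean_space \<Rightarrow> real) set" where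
  const: "(\<lambda>_. c) \<in> elementary"
| inner: "(\<lambda>x. x \<bullet> a) \<in> elementary"
| add: "f \<in> elementary \<Longrightarrow> g \<in> elementary \<Longrightarrow> (\<lambda>x. f x + g x) \<in> elementary"
| mult: "f \<in> elementary \<Longrightarrow> g \<in> elementary \<Longrightarrow> (\<lambda>x. f x * g x) \<in> elementary"
| inverse: "f \<in> elementary \<Longrightarrow> (\<And>x. f x \<noteq> 0) \<Longrightarrow> (\<lambda>x. inverse (f x)) \<in> elementary"
| flat: "f \<in> elementary \<Longrightarrow> (\<lambda>x. flat j (f x)) \<in> elementary"

lemma elementary_scale: "f \<in> elementary \<Longrightarrow> (\<lambda>x. c * f x) \<in> elementary"
  by (intro elementary.intros)

lemma elementary_minus: "f \<in> elementary \<Longrightarrow> (\<lambda>x. - f x) \<in> elementary"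
  using elementary_scale[of f "-1"] by simp

lemma elementary_diff: "f \<in> elementary \<Longrightarrow> g \<in> elementary \<Longrightarrow> (\<lambda>x. f x - g x) \<in> elementary"
  using elementary.add[of f "\<lambda>x. - g x"] elementary_minus[of g] by simp

lemma elementary_power: "f \<in> elementary \<Longrightarrow> (\<lambda>x. f x ^ n) \<in> elementary"
  by (induction n) (auto intro: elementary.intros)

lemma elementary_sum:
  "(\<And>i. i \<in> A \<Longrightarrow> f i \<in> elementary) \<Longrightarrow> (\<lambda>x. \<Sum>i\<in>A. f i x) \<in> elementary"
  by (induction A rule: infinite_finite_induct) (auto intro: elementary.intros)

lemma elementary_prod:
  "(\<And>i. i \<in> A \<Longrightarrow> f i \<in> elementary) \<Longrightarrow> (\<lambda>x. \<Prod>i\<in>A. f i x) \<in> elementary"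
  by (induction A rule: infinite_finite_induct) (auto intro: elementary.intros)

lemma elementary_nth: "(\<lambda>x::real^'n. x $ i) \<in> elementary"
  using elementary.inner[of "axis i (1::real)"] by (simp add: inner_axis)

lemma elementary_id: "(\<lambda>t::real. t) \<in> elementary"
  using elementary.inner[of "1::real"] by simp

lemma elementary_norm_power2: "(\<lambda>x. (norm x)\<^sup>2) \<in> elementary"
  unfolding power2_norm_eq_inner
  by (subst euclidean_inner, intro elementary_sum elementary.intros)

lemmas elementary_intros = elementary.intros elementary_scale elementary_minus elementary_diff
  elementary_power elementary_sum elementary_prod elementary_nth elementary_id elementary_norm_power2

lemma elementary_compose:
  fixes f :: "real \<Rightarrow> real"
  assumes "f \<in> elementary" "q \<in> elementary"
  shows "(\<lambda>x. f (q x)) \<in> elementary"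
  using assms(1) by induction (auto intro!: elementary_intros assms(2))

lemma elementary_has_derivative:
  assumes "f \<in> elementary"
  shows "\<exists>f'. (\<forall>x. (f has_derivative f' x) (at x)) \<and> (\<forall>b. (\<lambda>x. f' x b) \<in> elementary)"
  using assms
proof induction
  case (const c)
  show ?case by (intro exI[of _ "\<lambda>x h. 0"]) (auto intro: elementary_intros)
next
  case (inner a)
  show ?case
    by (intro exI[of _ "\<lambda>x h. h \<bullet> a"]) (auto intro!: elementary_intros derivative_eq_intros)
next
  case (add f g)
  then obtain f' g' where
    "\<forall>x. (f has_derivative f' x) (at x)" "\<forall>b. (\<lambda>x. f' x b) \<in> elementary"
    "\<forall>x. (g has_derivative g' x) (at x)" "\<forall>b. (\<lambda>x. g' x b) \<in> elementary" by blast
  then show ?case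
    by (intro exI[of _ "\<lambda>x h. f' x h + g' x h"]) (auto intro!: elementary_intros derivative_intros)
next
  case (mult f g)
  then obtain f' g' where
    "\<forall>x. (f has_derivative f' x) (at x)" "\<forall>b. (\<lambda>x. f' x b) \<in> elementary"
    "\<forall>x. (g has_derivative g' x) (at x)" "\<forall>b. (\<lambda>x. g' x b) \<in> elementary" by blast
  with mult show ?case
    by (intro exI[of _ "\<lambda>x h. f x * g' x h + f' x h * g x"])
       (auto intro!: elementary_intros has_derivative_mult)
next
  case (inverse f)
  then obtain f' where
    "\<forall>x. (f has_derivative f' x) (at x)" "\<forall>b. (\<lambda>x. f' x b) \<in> elementary" by blast
  with inverse show ?case
    by (intro exI[of _ "\<lambda>x h. - (inverse (f x) * f' x h * inverse (f x))"])
       (auto intro!: elementary_intros has_derivative_inverse)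
next
  case (flat f j)
  then obtain f' where f':
    "\<forall>x. (f has_derivative f' x) (at x)" "\<forall>b. (\<lambda>x. f' x b) \<in> elementary" by blast
  have "((\<lambda>x. flat j (f x)) has_derivative
      (\<lambda>h. f' x h * (flat (j + 2) (f x) - j * flat (j + 1) (f x)))) (at x)" for x
    using DERIV_compose_FDERIV[OF has_real_derivative_flat f'(1)[rule_format]] .
  with flat f' show ?case
    by (intro exI[of _ "\<lambda>x h. f' x h * (flat (j + 2) (f x) - j * flat (j + 1) (f x))"])
       (auto intro!: elementary_intros)
qed

text \<open>
  Vector-valued functions are included because the induction passes to partial derivatives of the
  same function, which are again vector-valued with components in the class.
\<close>
lemma elementary_C_k:
  fixes f :: "'a::euclidean_space \<Rightarrow> 'b::euclidean_space"
  assumes "\<And>i. i \<in> Basis \<Longrightarrow> (\<lambda>x. f x \<bullet> i) \<in> elementary"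
  shows "C_k k f"
  using assms
proof (induction k arbitrary: f)
  case (0 f)
  have "continuous_on UNIV (\<lambda>x. f x \<bullet> i)" if "i \<in> Basis" for i
    using elementary_has_derivative[OF 0(1)[OF that]]
    by (blast intro: continuous_at_imp_continuous_on has_derivative_continuous)
  then show ?case by (simp add: continuous_on_componentwise[of UNIV f])
next
  case (Suc k f)
  have "\<forall>i\<in>Basis. \<exists>f'. (\<forall>x. ((\<lambda>x. f x \<bullet> i) has_derivative f' x) (at x))
      \<and> (\<forall>b. (\<lambda>x. f' x b) \<in> elementary)"
    using elementary_has_derivative[OF Suc.prems] by blast
  then obtain f' where f': "\<And>i x. i \<in> Basis \<Longrightarrow> ((\<lambda>x. f x \<bullet> i) has_derivative f' i x) (at x)"
      "\<And>i b. i \<in> Basis \<Longrightarrow> (\<lambda>x. f' i x b) \<in> elementary"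
    by metis
  define D where "D = (\<lambda>x h. \<Sum>i\<in>Basis. f' i x h *\<^sub>R i)"
  have D: "(f has_derivative D x) (at x)" for x
    unfolding has_derivative_componentwise_within[of f]
    using f'(1) by (auto simp: D_def inner_sum_left inner_Basis if_distrib cong: if_cong)
  have "C_k k (\<lambda>x. D x b)" for b
    by (rule Suc.IH) (auto simp: D_def inner_sum_left inner_Basis if_distrib f'(2) cong: if_cong)
  moreover have "frechet_derivative f (at x) = D x" for x
    using frechet_derivative_at[OF D] by simp
  ultimately show ?case
    using D by (auto simp: differentiable_def)
qed

lemma elementary_smooth:
  fixes f :: "real^'n \<Rightarrow> real^'m"
  assumes "\<And>i. (\<lambda>x. f x $ i) \<in> elementary"
  shows "smooth f"
  unfolding smooth_def
  by (intro allI elementary_C_k) (use assms in \<open>auto simp: Basis_vec_def inner_axis\<close>)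

lemma elementary_smooth_real:
  assumes "f \<in> elementary"
  shows "smooth f"
  unfolding smooth_def
  by (intro allI elementary_C_k) (use assms in auto)

section \<open>Square-integrable fields and classical gradients\<close>

lemma (in finite_measure) square_integrable_integrable:
  assumes "square_integrable M f"
  shows "integrable M f"
proof -
  have f: "f \<in> borel_measurable M" and f2: "integrable M (\<lambda>x. (norm (f x))\<^sup>2)"
    using assms unfolding square_integrable_def by blast+
  have "integrable M (\<lambda>x. norm (f x))"
  proof (rule square_integrable_imp_integrable)
    show "(\<lambda>x. norm (f x)) \<in> borel_measurable M"
      using f by simp
  qed (rule f2)
  then show ?thesis using f by (rule integrable_norm_cancel)
qed

lemma (in finite_measure) integral_norm_le_l2_norm:
  assumes "square_integrable M f"
  shows "(\<integral>x. norm (f x) \<partial>M) \<le> sqrt (measure M (space M)) * l2_norm M f"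
proof -
  have [measurable]: "f \<in> borel_measurable M" and f2: "integrable M (\<lambda>x. (norm (f x))\<^sup>2)"
    using assms by (auto simp: square_integrable_def)
  have f1: "integrable M (\<lambda>x. norm (f x))"
    using square_integrable_integrable[OF assms] by simp
  have "(\<integral>\<^sup>+x. ennreal (norm (f x)) * 1 \<partial>M)\<^sup>2
      \<le> (\<integral>\<^sup>+x. (ennreal (norm (f x)))\<^sup>2 \<partial>M) * (\<integral>\<^sup>+x. 1\<^sup>2 \<partial>M)"
    by (rule Cauchy_Schwarz_nn_integral) auto
  also have "(\<integral>\<^sup>+x. (ennreal (norm (f x)))\<^sup>2 \<partial>M) = ennreal (\<integral>x. (norm (f x))\<^sup>2 \<partial>M)"
    using f2 by (simp add: ennreal_power nn_integral_eq_integral)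
  also have "(\<integral>\<^sup>+x. 1\<^sup>2 \<partial>M) = ennreal (measure M (space M))"
    by (simp add: emeasure_eq_measure)
  also have "(\<integral>\<^sup>+x. ennreal (norm (f x)) * 1 \<partial>M) = ennreal (\<integral>x. norm (f x) \<partial>M)"
    using f1 by (simp add: nn_integral_eq_integral)
  finally have "(\<integral>x. norm (f x) \<partial>M)\<^sup>2 \<le> (\<integral>x. (norm (f x))\<^sup>2 \<partial>M) * measure M (space M)"
    by (simp add: ennreal_power ennreal_mult[symmetric] integral_nonneg_AE)
  then have "(\<integral>x. norm (f x) \<partial>M) \<le> sqrt ((\<integral>x. (norm (f x))\<^sup>2 \<partial>M) * measure M (space M))"
    by (rule real_le_rsqrt)
  then show ?thesis by (simp add: l2_norm_def real_sqrt_mult mult.commute)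
qed

lemma square_integrable_diff:
  assumes "square_integrable M f" "square_integrable M g"
  shows "square_integrable M (\<lambda>x. f x - g x)"
proof -
  have [measurable]: "f \<in> borel_measurable M" "g \<in> borel_measurable M"
    using assms by (auto simp: square_integrable_def)
  have "integrable M (\<lambda>x. 2 * (norm (f x))\<^sup>2 + 2 * (norm (g x))\<^sup>2)"
    using assms by (auto simp: square_integrable_def)
  then have "integrable M (\<lambda>x. (norm (f x - g x))\<^sup>2)"
  proof (rule Bochner_Integration.integrable_bound)
    have "(norm (f x - g x))\<^sup>2 \<le> 2 * (norm (f x))\<^sup>2 + 2 * (norm (g x))\<^sup>2" for x
    proof -
      have "(norm (f x - g x))\<^sup>2 \<le> (norm (f x) + norm (g x))\<^sup>2"
        by (intro power_mono norm_triangle_ineq4) auto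
      also have "\<dots> \<le> 2 * (norm (f x))\<^sup>2 + 2 * (norm (g x))\<^sup>2"
        using sum_squares_bound[of "norm (f x)" "norm (g x)"] by (simp add: power2_sum)
      finally show ?thesis .
    qed
    then show "AE x in M. norm ((norm (f x - g x))\<^sup>2) \<le> norm (2 * (norm (f x))\<^sup>2 + 2 * (norm (g x))\<^sup>2)"
      by auto
  qed auto
  then show ?thesis by (auto simp: square_integrable_def)
qed

lemma square_integrable_continuous_lebesgue_on:
  fixes f :: "'a::euclidean_space \<Rightarrow> 'b::euclidean_space"
  assumes "open \<Omega>" "bounded \<Omega>" and f: "continuous_on UNIV f"
  shows "square_integrable (lebesgue_on \<Omega>) f"
proof -
  interpret finite_measure "lebesgue_on \<Omega>"
    using assms by (intro finite_measure_lebesgue_on bounded_set_imp_lmeasurable) auto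
  have [measurable]: "f \<in> borel_measurable (lebesgue_on \<Omega>)"
    using f assms(1)
    by (intro continuous_imp_measurable_on_sets_lebesgue) (auto intro: continuous_on_subset)
  have "compact (f ` closure \<Omega>)"
    using assms by (intro compact_continuous_image) (auto intro: continuous_on_subset)
  then obtain B where "\<And>x. x \<in> closure \<Omega> \<Longrightarrow> norm (f x) \<le> B"
    by (meson bounded_iff compact_imp_bounded imageI)
  then have "norm (f x) \<le> B" if "x \<in> \<Omega>" for x
    using that closure_subset by blast
  then have "integrable (lebesgue_on \<Omega>) (\<lambda>x. (norm (f x))\<^sup>2)"
    by (intro integrable_const_bound[of _ "B\<^sup>2"]) (auto intro!: power_mono)
  then show ?thesis by (auto simp: square_integrable_def)
qed

lemma lebesgue_on_integral_eq_lborel: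
  fixes g :: "'a::euclidean_space \<Rightarrow> real"
  assumes "open \<Omega>" "continuous_on UNIV g" "\<And>x. x \<notin> \<Omega> \<Longrightarrow> g x = 0"
  shows "(\<integral>x. g x \<partial>lebesgue_on \<Omega>) = (\<integral>x. g x \<partial>lborel)"
proof -
  have "(\<integral>x. g x \<partial>lebesgue_on \<Omega>) = (\<integral>x. (if x \<in> \<Omega> then g x else 0) \<partial>lebesgue)"
    using assms(1) by (intro Lebesgue_Measure.integral_restrict_UNIV[symmetric]) (auto simp: lborelD)
  also have "(\<lambda>x. if x \<in> \<Omega> then g x else 0) = g"
    using assms by auto
  also have "(\<integral>x. g x \<partial>lebesgue) = (\<integral>x. g x \<partial>lborel)"
    using assms by (intro integral_completion) (simp add: borel_measurable_continuous_onI)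
  finally show ?thesis .
qed

text \<open>
  The integral of a difference quotient vanishes by translation invariance of Lebesgue measure, and
  the difference quotients converge boundedly to the derivative. In this way no iterated integrals
  are needed.
\<close>
lemma integral_directional_derivative_eq_0:
  fixes F :: "'a::euclidean_space \<Rightarrow> real"
  assumes der: "\<And>x. (F has_derivative F' x) (at x)"
    and cont: "continuous_on UNIV (\<lambda>x. F' x b)"
    and K: "bounded K" "\<And>x. x \<notin> K \<Longrightarrow> F x = 0"
  shows "(\<integral>x. F' x b \<partial>lborel) = 0"
proof -
  obtain R where R: "\<And>x. x \<in> K \<Longrightarrow> norm x \<le> R"
    using K(1) by (auto simp: bounded_iff)
  define h where "h = (\<lambda>n. 1 / real (Suc n))"
  have h: "0 < h n" "h n \<le> 1" for n by (auto simp: h_def)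
  define q where "q = (\<lambda>n x. (F (x + h n *\<^sub>R b) - F x) / h n)"
  have "continuous_on UNIV F"
    by (meson der continuous_at_imp_continuous_on has_derivative_continuous)
  then have cF: "continuous_on A F" for A by (rule continuous_on_subset) auto
  have [measurable]: "F \<in> borel_measurable borel" "(\<lambda>x. F' x b) \<in> borel_measurable borel"
    using cF cont by (auto intro: borel_measurable_continuous_onI)
  have Fint: "integrable lborel F"
  proof -
    have "integrable lborel (\<lambda>x. indicator (cball 0 R) x *\<^sub>R F x)"
      by (rule borel_integrable_compact) (auto intro: cF)
    also have "(\<lambda>x. indicator (cball 0 R) x *\<^sub>R F x) = F"
      using K(2) R by (auto simp: indicator_def fun_eq_iff)
    finally show ?thesis .
  qed
  have "compact ((\<lambda>x. F' x b) ` cball 0 (R + 2 * norm b))"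
    using cont by (intro compact_continuous_image) (auto intro: continuous_on_subset)
  then obtain B where "\<forall>y \<in> (\<lambda>x. F' x b) ` cball 0 (R + 2 * norm b). norm y \<le> B"
    by (meson bounded_iff compact_imp_bounded)
  then have B: "\<bar>F' x b\<bar> \<le> B" if "norm x \<le> R + 2 * norm b" for x
    using that by auto
  have q_lim: "(\<lambda>n. q n x) \<longlonglongrightarrow> F' x b" for x
  proof -
    have "((\<lambda>t. F (x + t *\<^sub>R b)) has_derivative (\<lambda>t. F' x (t *\<^sub>R b))) (at 0)"
      by (rule has_derivative_compose[of "\<lambda>t. x + t *\<^sub>R b"])
         (auto intro!: derivative_eq_intros der)
    then have "((\<lambda>t. F (x + t *\<^sub>R b)) has_real_derivative F' x b) (at 0)"
      unfolding has_field_derivative_def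
      by (rule has_derivative_eq_rhs)
         (auto simp: linear_cmul[OF has_derivative_linear[OF der]])
    then have "((\<lambda>t. (F (x + t *\<^sub>R b) - F x) / t) \<longlongrightarrow> F' x b) (at 0)"
      by (simp add: DERIV_def)
    moreover have "filterlim h (at 0) sequentially"
      unfolding h_def filterlim_at
      using LIMSEQ_inverse_real_of_nat by (auto simp: inverse_eq_divide simp del: of_nat_Suc)
    ultimately show ?thesis
      unfolding q_def by (rule filterlim_compose)
  qed
  \<comment> \<open>For steps \<open>h \<le> 1\<close> the quotients vanish off a fixed ball, and by the mean value theorem they are
    bounded by the derivative on a slightly larger one.\<close>
  have q_bound: "norm (q n x) \<le> indicator (cball 0 (R + norm b)) x * B" for n x
  proof (cases "norm x \<le> R + norm b")
    case True
    have "\<exists>z\<in>{0<..<h n}. F (x + h n *\<^sub>R b) - F (x + 0 *\<^sub>R b) = F' (x + z *\<^sub>R b) ((h n - 0) *\<^sub>R b)"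
    proof -
      have "((\<lambda>t. F (x + t *\<^sub>R b)) has_derivative (\<lambda>t. F' (x + z *\<^sub>R b) (t *\<^sub>R b))) (at z within {0..h n})"
        for z
        by (rule has_derivative_compose[of "\<lambda>t. x + t *\<^sub>R b"])
           (auto intro!: derivative_eq_intros der)
      then show ?thesis
        using mvt_simple[OF h(1)[of n], of "\<lambda>t. F (x + t *\<^sub>R b)" "\<lambda>z t. F' (x + z *\<^sub>R b) (t *\<^sub>R b)"]
        by auto
    qed
    then obtain z where z: "0 < z" "z < h n"
        "F (x + h n *\<^sub>R b) - F x = h n * F' (x + z *\<^sub>R b) b"
      by (auto simp: linear_cmul[OF has_derivative_linear[OF der]])
    have "norm (x + z *\<^sub>R b) \<le> norm x + z * norm b"
      using z norm_triangle_ineq[of x "z *\<^sub>R b"] by simp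
    also have "\<dots> \<le> norm x + 1 * norm b"
      using z h(2)[of n] by (intro add_left_mono mult_right_mono) auto
    also have "\<dots> \<le> R + 2 * norm b" using True by simp
    finally have "\<bar>F' (x + z *\<^sub>R b) b\<bar> \<le> B" by (rule B)
    then show ?thesis using z h(1)[of n] True by (simp add: q_def)
  next
    case False
    have "norm x - norm b \<le> norm (x + h n *\<^sub>R b)"
    proof -
      have "norm x \<le> norm (x + h n *\<^sub>R b) + norm (h n *\<^sub>R b)"
        using norm_triangle_ineq4[of "x + h n *\<^sub>R b" "h n *\<^sub>R b"] by simp
      moreover have "norm (h n *\<^sub>R b) \<le> 1 * norm b"
        unfolding norm_scaleR using h[of n] by (intro mult_right_mono) auto
      ultimately show ?thesis by simp
    qed
    then have "\<not> norm (x + h n *\<^sub>R b) \<le> R" "\<not> norm x \<le> R"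
      using False norm_ge_zero[of b] by linarith+
    then have "F (x + h n *\<^sub>R b) = 0" "F x = 0" using K(2) R by blast+
    then show ?thesis using False by (simp add: q_def)
  qed
  have q_int: "(\<integral>x. q n x \<partial>lborel) = 0" for n
  proof -
    have "integrable (distr lborel borel ((+) (h n *\<^sub>R b))) F"
      using Fint by (simp add: lborel_distr_plus)
    then have "integrable lborel (\<lambda>x. F (h n *\<^sub>R b + x))"
      by (subst (asm) integrable_distr_eq) auto
    moreover have "(\<integral>x. F x \<partial>distr lborel borel ((+) (h n *\<^sub>R b))) = (\<integral>x. F (h n *\<^sub>R b + x) \<partial>lborel)"
      by (subst integral_distr) auto
    ultimately show ?thesis
      using Fint unfolding q_def by (simp add: lborel_distr_plus add.commute)
  qed
  have "(\<lambda>n. \<integral>x. q n x \<partial>lborel) \<longlonglongrightarrow> (\<integral>x. F' x b \<partial>lborel)"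
  proof (rule integral_dominated_convergence)
    show "q n \<in> borel_measurable lborel" for n
      unfolding q_def by measurable
    show "integrable lborel (\<lambda>x::'a. indicator (cball 0 (R + norm b)) x * B)"
      by (intro integrable_mult_left integrable_real_indicator)
         (use emeasure_bounded_finite[of "cball (0::'a) (R + norm b)"] in auto)
  qed (use q_lim q_bound in auto)
  then show ?thesis
    by (simp add: q_int LIMSEQ_const_iff)
qed

lemma smooth_C1:
  fixes w :: "'a::euclidean_space \<Rightarrow> 'b::euclidean_space"
  assumes "smooth w"
  shows "(w has_derivative frechet_derivative w (at x)) (at x)"
    and "b \<in> Basis \<Longrightarrow> continuous_on UNIV (\<lambda>x. frechet_derivative w (at x) b)"
    and "continuous_on UNIV w"
proof -
  have "C_k (Suc 0) w" "C_k 0 w"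
    using assms unfolding smooth_def by blast+
  then show "(w has_derivative frechet_derivative w (at x)) (at x)"
    and "b \<in> Basis \<Longrightarrow> continuous_on UNIV (\<lambda>x. frechet_derivative w (at x) b)"
    and "continuous_on UNIV w"
    by (auto simp: frechet_derivative_works)
qed

lemma test_function_C1:
  fixes \<phi> :: "'a::euclidean_space \<Rightarrow> real"
  assumes "\<phi> \<in> test_functions \<Omega>"
  shows "(\<phi> has_derivative frechet_derivative \<phi> (at x)) (at x)"
    and "b \<in> Basis \<Longrightarrow> continuous_on UNIV (\<lambda>x. frechet_derivative \<phi> (at x) b)"
    and "continuous_on UNIV \<phi>"
  using assms smooth_C1[of \<phi>] by (auto simp: test_functions_def)

lemma test_function_support:
  assumes "\<phi> \<in> test_functions \<Omega>"
  shows "bounded {x. \<phi> x \<noteq> 0}" "\<phi> x \<noteq> 0 \<Longrightarrow> x \<in> \<Omega>"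
proof -
  show "bounded {x. \<phi> x \<noteq> 0}"
    using assms closure_subset[of "{x. \<phi> x \<noteq> 0}"] unfolding test_functions_def
    by (metis (mono_tags, lifting) bounded_subset compact_imp_bounded mem_Collect_eq)
  show "x \<in> \<Omega>" if "\<phi> x \<noteq> 0"
    using assms closure_subset[of "{x. \<phi> x \<noteq> 0}"] that unfolding test_functions_def by auto
qed

lemma test_function_derivative_support:
  fixes \<phi> :: "'a::euclidean_space \<Rightarrow> real"
  assumes "\<phi> \<in> test_functions \<Omega>" "x \<notin> \<Omega>"
  shows "frechet_derivative \<phi> (at x) b = 0"
proof -
  let ?S = "{x. \<phi> x \<noteq> 0}"
  have x: "x \<in> - closure ?S" using assms by (auto simp: test_functions_def)
  have "((\<lambda>_. 0::real) has_derivative (\<lambda>_. 0)) (at x)" by simp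
  then have "(\<phi> has_derivative (\<lambda>_. 0)) (at x)"
  proof (rule has_derivative_transform_within_open)
    show "open (- closure ?S)" by (intro open_Compl closed_closure)
    show "x \<in> - closure ?S" by (rule x)
    show "0 = \<phi> y" if "y \<in> - closure ?S" for y
      using that closure_subset[of ?S] by auto
  qed
  from frechet_derivative_at[OF this] show ?thesis by metis
qed

lemma has_weak_grad_classical:
  fixes f :: "real^'n \<Rightarrow> real^'m"
  assumes \<Omega>: "open \<Omega>" "bounded \<Omega>"
    and der: "\<And>x. (f has_derivative f' x) (at x)"
    and cont: "\<And>j. continuous_on UNIV (\<lambda>x. f' x (axis j 1))"
  shows "has_weak_grad \<Omega> f (\<lambda>x. matrix (f' x))"
  unfolding has_weak_grad_def
proof (intro conjI allI impI)
  have cf: "continuous_on UNIV f"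
    by (meson der continuous_at_imp_continuous_on has_derivative_continuous)
  show "square_integrable (lebesgue_on \<Omega>) f"
    using \<Omega> cf by (rule square_integrable_continuous_lebesgue_on)
  have "continuous_on UNIV (\<lambda>x. matrix (f' x))"
    unfolding matrix_def by (intro continuous_on_vec_lambda continuous_on_component cont)
  with \<Omega> show "square_integrable (lebesgue_on \<Omega>) (\<lambda>x. matrix (f' x))"
    by (rule square_integrable_continuous_lebesgue_on)
  fix \<phi> :: "real^'n \<Rightarrow> real" and i j
  assume \<phi>: "\<phi> \<in> test_functions \<Omega>"
  let ?D = "\<lambda>x. frechet_derivative \<phi> (at x)"
  have ax: "axis j 1 \<in> (Basis :: (real^'n) set)" by (simp add: axis_in_Basis_iff)
  note C1 = test_function_C1(1)[OF \<phi>] test_function_C1(2)[OF \<phi> ax] test_function_C1(3)[OF \<phi>]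
  have c1: "continuous_on UNIV (\<lambda>x. f x $ i * ?D x (axis j 1))"
    by (intro continuous_intros cf C1)
  have c2: "continuous_on UNIV (\<lambda>x. f' x (axis j 1) $ i * \<phi> x)"
    by (intro continuous_intros cont C1)
  have z1: "f x $ i * ?D x (axis j 1) = 0" and z2: "f' x (axis j 1) $ i * \<phi> x = 0" if "x \<notin> \<Omega>" for x
    using that test_function_derivative_support[OF \<phi>] test_function_support(2)[OF \<phi>] by auto
  have "(\<integral>x. f x $ i * ?D x (axis j 1) + f' x (axis j 1) $ i * \<phi> x \<partial>lborel) = 0"
  proof (rule integral_directional_derivative_eq_0)
    show "((\<lambda>x. f x $ i * \<phi> x) has_derivative (\<lambda>h. f x $ i * ?D x h + f' x h $ i * \<phi> x)) (at x)" for x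
      by (intro has_derivative_mult bounded_linear.has_derivative[OF bounded_linear_vec_nth] der C1)
    show "bounded {x. \<phi> x \<noteq> 0}" using \<phi> by (rule test_function_support)
  qed (use c1 c2 in \<open>auto intro: continuous_intros\<close>)
  then have "(\<integral>x. f x $ i * ?D x (axis j 1) + f' x (axis j 1) $ i * \<phi> x \<partial>lebesgue_on \<Omega>) = 0"
    using z1 z2
    by (subst lebesgue_on_integral_eq_lborel[OF \<Omega>(1) continuous_on_add[OF c1 c2]])
       (metis add.left_neutral, assumption)
  moreover have "integrable (lebesgue_on \<Omega>) (\<lambda>x. f x $ i * ?D x (axis j 1))"
      "integrable (lebesgue_on \<Omega>) (\<lambda>x. f' x (axis j 1) $ i * \<phi> x)"
    using \<Omega> c1 c2
    by (auto intro!: finite_measure.square_integrable_integrable finite_measure_lebesgue_on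
        bounded_set_imp_lmeasurable square_integrable_continuous_lebesgue_on)
  ultimately show "(\<integral>x. f x $ i * ?D x (axis j 1) \<partial>lebesgue_on \<Omega>)
      = - (\<integral>x. matrix (f' x) $ i $ j * \<phi> x \<partial>lebesgue_on \<Omega>)"
    by (simp add: matrix_def)
qed

section \<open>Uniqueness of weak gradients\<close>

text \<open>Dilating the flat function yields test functions that increase to indicators of open boxes.\<close>
lemma tendsto_flat_scaled:
  "(\<lambda>n. flat 0 (real (Suc n) * t)) \<longlonglongrightarrow> (if 0 < t then 1 else 0)"
proof (cases "0 < t")
  case True
  have "(\<lambda>n. exp (- (inverse (real (Suc n)) * inverse t))) \<longlonglongrightarrow> exp (- (0 * inverse t))"
    by (intro tendsto_intros LIMSEQ_inverse_real_of_nat)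
  then show ?thesis
    using True by (simp add: flat_def inverse_eq_divide mult_pos_pos del: of_nat_Suc)
next
  case False
  then have "\<not> 0 < real (Suc n) * t" for n
    by (simp add: zero_less_mult_iff del: of_nat_Suc)
  with False show ?thesis by (simp add: flat_def)
qed

lemma flat_0_bounds: "0 \<le> flat 0 t" "flat 0 t \<le> 1"
  by (auto simp: flat_def)

lemma smooth_test_function:
  assumes "smooth \<phi>" "compact K" "K \<subseteq> \<Omega>" "\<And>x. x \<notin> K \<Longrightarrow> \<phi> x = 0"
  shows "\<phi> \<in> test_functions \<Omega>"
proof -
  have "closure {x. \<phi> x \<noteq> 0} \<subseteq> K"
    using assms by (intro closure_minimal) (auto intro: compact_imp_closed)
  moreover from this have "compact (closure {x. \<phi> x \<noteq> 0})"
    using assms(2) by (metis closed_closure compact_Int_closed inf.absorb_iff2)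
  ultimately show ?thesis
    using assms(1,3) by (auto simp: test_functions_def)
qed

lemma integral_box_eq_0:
  fixes d :: "real^'n \<Rightarrow> real"
  assumes \<Omega>: "open \<Omega>" and d: "integrable (lebesgue_on \<Omega>) d"
    and zero: "\<And>\<phi>. \<phi> \<in> test_functions \<Omega> \<Longrightarrow> (\<integral>x. d x * \<phi> x \<partial>lebesgue_on \<Omega>) = 0"
    and ab: "cbox a b \<subseteq> \<Omega>"
  shows "(\<integral>x. d x * indicator (box a b) x \<partial>lebesgue_on \<Omega>) = 0"
proof -
  define \<phi> :: "nat \<Rightarrow> real^'n \<Rightarrow> real" where
    "\<phi> = (\<lambda>n x. \<Prod>i\<in>UNIV. flat 0 (real (Suc n) * (x $ i - a $ i)) * flat 0 (real (Suc n) * (b $ i - x $ i)))"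
  have elem: "\<phi> n \<in> elementary" for n
    unfolding \<phi>_def by (intro elementary_intros)
  have out: "\<phi> n x = 0" if "x \<notin> cbox a b" for n x
  proof -
    from that obtain i where "\<not> (a $ i \<le> x $ i \<and> x $ i \<le> b $ i)"
      by (auto simp: mem_box_cart)
    then have "flat 0 (real (Suc n) * (x $ i - a $ i)) * flat 0 (real (Suc n) * (b $ i - x $ i)) = 0"
      by (auto simp: flat_def zero_less_mult_iff simp del: of_nat_Suc)
    then show ?thesis unfolding \<phi>_def by (metis (mono_tags, lifting) UNIV_I finite prod_zero)
  qed
  have test: "\<phi> n \<in> test_functions \<Omega>" for n
    by (rule smooth_test_function[OF elementary_smooth_real[OF elem] _ ab out]) auto
  have bound: "\<bar>\<phi> n x\<bar> \<le> 1" for n x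
  proof -
    have "0 \<le> \<phi> n x \<and> \<phi> n x \<le> 1"
      unfolding \<phi>_def using flat_0_bounds
      by (intro conjI prod_nonneg prod_le_1) (auto intro!: mult_le_one mult_nonneg_nonneg simp del: of_nat_Suc)
    then show ?thesis by auto
  qed
  have lim: "(\<lambda>n. \<phi> n x) \<longlonglongrightarrow> indicator (box a b) x" for x
  proof -
    have "(\<lambda>n. \<phi> n x) \<longlonglongrightarrow> (\<Prod>i\<in>UNIV. (if 0 < x $ i - a $ i then 1 else 0) * (if 0 < b $ i - x $ i then 1 else 0))"
      unfolding \<phi>_def by (intro tendsto_prod tendsto_mult tendsto_flat_scaled)
    also have "(\<Prod>i\<in>UNIV. (if 0 < x $ i - a $ i then 1 else 0) * (if 0 < b $ i - x $ i then 1 else 0))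
        = (indicator (box a b) x :: real)"
      by (auto simp: indicator_def mem_box_cart split: if_splits)
    finally show ?thesis .
  qed
  have [measurable]: "\<phi> n \<in> borel_measurable (lebesgue_on \<Omega>)" for n
    using \<Omega> test_function_C1(3)[OF test]
    by (intro continuous_imp_measurable_on_sets_lebesgue) (auto intro: continuous_on_subset)
  have [measurable]: "d \<in> borel_measurable (lebesgue_on \<Omega>)"
    using d by simp
  have "(\<lambda>n. \<integral>x. d x * \<phi> n x \<partial>lebesgue_on \<Omega>) \<longlonglongrightarrow> (\<integral>x. d x * indicator (box a b) x \<partial>lebesgue_on \<Omega>)"
  proof (rule integral_dominated_convergence)
    show "integrable (lebesgue_on \<Omega>) (\<lambda>x. norm (d x))" using d by simp
    show "(\<lambda>x. d x * indicator (box a b) x) \<in> borel_measurable (lebesgue_on \<Omega>)"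
      by (rule borel_measurable_LIMSEQ_real[of _ "\<lambda>n x. d x * \<phi> n x"])
         (auto intro!: tendsto_intros lim)
    show "AE x in lebesgue_on \<Omega>. (\<lambda>n. d x * \<phi> n x) \<longlonglongrightarrow> d x * indicator (box a b) x"
      by (intro AE_I2 tendsto_intros lim)
    show "AE x in lebesgue_on \<Omega>. norm (d x * \<phi> n x) \<le> norm (d x)" for n
      using bound by (intro AE_I2) (auto simp: abs_mult intro: mult_left_le)
  qed auto
  then show ?thesis by (simp add: zero[OF test] LIMSEQ_const_iff)
qed

text \<open>
  The sets over which \<open>f\<close> integrates to zero form a Dynkin system, and the boxes are a generator of
  the Borel sets that is closed under intersections.
\<close>
lemma AE_eq_0_if_box_integrals_eq_0:
  fixes f :: "'a::euclidean_space \<Rightarrow> real"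
  assumes f: "integrable lborel f"
    and zero: "\<And>a b. (\<integral>x. f x * indicator (box a b) x \<partial>lborel) = 0"
  shows "AE x in lborel. f x = 0"
proof -
  have fi: "integrable lborel (\<lambda>x. f x * indicator A x)" if "A \<in> sets borel" for A
    using that f by (intro integrable_real_mult_indicator) auto
  have [measurable]: "f \<in> borel_measurable borel" using f by simp
  define G :: "'a set set" where "G = range (\<lambda>(a, b). box a b)"
  have UNIV: "(\<integral>x. f x \<partial>lborel) = 0"
  proof -
    have "(\<lambda>n. \<integral>x. f x * indicator (box (- real n *\<^sub>R One) (real n *\<^sub>R One)) x \<partial>lborel)
        \<longlonglongrightarrow> (\<integral>x. f x \<partial>lborel)"
    proof (rule integral_dominated_convergence)
      show "integrable lborel (\<lambda>x. norm (f x))" using f by simp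
      have "(\<lambda>n. f x * indicator (box (- real n *\<^sub>R One) (real n *\<^sub>R One)) x) \<longlonglongrightarrow> f x" for x
      proof -
        have "x \<in> (\<Union>n. box (- real n *\<^sub>R One) (real n *\<^sub>R One))" by (simp add: UN_box_eq_UNIV)
        then obtain N where N: "x \<in> box (- real N *\<^sub>R One) (real N *\<^sub>R One)" by auto
        have "x \<in> box (- real n *\<^sub>R One) (real n *\<^sub>R One)" if "N \<le> n" for n
        proof -
          have "real N \<le> real n" using that by simp
          then show ?thesis using N by (fastforce simp: mem_box)
        qed
        then have "eventually (\<lambda>n. f x = f x * indicator (box (- real n *\<^sub>R One) (real n *\<^sub>R One)) x) sequentially"
          by (auto simp: eventually_sequentially intro!: exI[of _ N])
        then show ?thesis by (rule Lim_transform_eventually[OF tendsto_const])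
      qed
      then show "AE x in lborel. (\<lambda>n. f x * indicator (box (- real n *\<^sub>R One) (real n *\<^sub>R One)) x) \<longlonglongrightarrow> f x"
        by simp
    qed (auto simp: indicator_def)
    then show ?thesis by (simp add: zero LIMSEQ_const_iff)
  qed
  have "(\<integral>x. f x * indicator A x \<partial>lborel) = 0" if "A \<in> sigma_sets UNIV G" for A
  proof -
    have sb: "sets borel = sigma_sets UNIV G"
      by (simp add: borel_eq_box G_def)
    have "Int_stable G"
      by (auto simp: Int_stable_def G_def box_Int_box)
    moreover have "G \<subseteq> Pow UNIV" by simp
    ultimately show ?thesis using that
    proof (induction A rule: sigma_sets_induct_disjoint)
      case (basic A)
      then show ?case using zero by (auto simp: G_def)
    next
      case (compl A)
      have "(\<integral>x. f x * indicator (UNIV - A) x \<partial>lborel) = (\<integral>x. f x - f x * indicator A x \<partial>lborel)"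
        by (intro Bochner_Integration.integral_cong) (auto simp: indicator_def)
      also have "\<dots> = 0" using compl f fi[of A] UNIV sb by simp
      finally show ?case .
    next
      case (union A)
      have A: "A n \<in> sets lborel" for n using union sb by auto
      have "(\<integral>x. f x * indicator (\<Union>n. A n) x \<partial>lborel) = set_lebesgue_integral lborel (\<Union>n. A n) f"
        by (simp add: set_lebesgue_integral_def mult.commute)
      also have "\<dots> = (\<Sum>n. set_lebesgue_integral lborel (A n) f)"
        using union(1) A fi[of "\<Union>n. A n"]
        by (intro lebesgue_integral_countable_add)
           (auto simp: disjoint_family_on_def set_integrable_def mult.commute)
      also have "\<dots> = 0"
        using union(3) by (simp add: set_lebesgue_integral_def mult.commute)
      finally show ?case .
    qed simp
  qed
  then have "set_lebesgue_integral lborel A f = 0" if "A \<in> sets lborel" for A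
    using that by (simp add: borel_eq_box G_def set_lebesgue_integral_def mult.commute)
  with f show ?thesis by (rule sigma_finite_measure.density_zero[OF sigma_finite_lborel])
qed

text \<open>
  The fundamental lemma of the calculus of variations. On each box inside \<open>\<Omega>\<close> the cut-off function
  has a Borel representative all of whose box integrals vanish, since the intersection of two boxes
  is a box; countably many boxes cover \<open>\<Omega>\<close>.
\<close>
lemma AE_eq_0_if_test_integrals_eq_0:
  fixes d :: "real^'n \<Rightarrow> real"
  assumes \<Omega>: "open \<Omega>" and d: "integrable (lebesgue_on \<Omega>) d"
    and zero: "\<And>\<phi>. \<phi> \<in> test_functions \<Omega> \<Longrightarrow> (\<integral>x. d x * \<phi> x \<partial>lebesgue_on \<Omega>) = 0"
  shows "AE x in lebesgue_on \<Omega>. d x = 0"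
proof -
  have \<Omega>s: "\<Omega> \<in> sets lebesgue" using \<Omega> by (simp add: lborelD)
  have box_0: "AE x in lborel. x \<in> box a b \<longrightarrow> d x = 0" if ab: "cbox a b \<subseteq> \<Omega>" for a b
  proof -
    have sub: "box a b \<subseteq> \<Omega>" using ab box_subset_cbox by blast
    define f where "f = (\<lambda>x. if x \<in> \<Omega> then d x * indicator (box a b) x else 0)"
    have "integrable (lebesgue_on \<Omega>) (\<lambda>x. d x * indicator (box a b) x)"
      using d sub \<Omega>s by (intro integrable_real_mult_indicator) (auto simp: sets_restrict_space)
    then have "integrable lebesgue (\<lambda>x. indicator \<Omega> x *\<^sub>R (d x * indicator (box a b) x))"
      using \<Omega>s by (simp add: integrable_restrict_space)
    also have "(\<lambda>x. indicator \<Omega> x *\<^sub>R (d x * indicator (box a b) x)) = f"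
      by (auto simp: f_def indicator_def)
    finally have fi: "integrable lebesgue f" .
    then obtain f' where f': "f' \<in> borel_measurable lborel" "AE x in lborel. f x = f' x"
      using completion_ex_borel_measurable_real[of f lborel] by auto
    then have ae: "AE x in lebesgue. f x = f' x" by (simp add: AE_completion)
    have f'm: "f' \<in> borel_measurable lebesgue" using f'(1) by (rule measurable_completion)
    have fm: "f \<in> borel_measurable lebesgue" using fi by simp
    have f'i: "integrable lborel f'"
      using fi integrable_cong_AE[OF fm f'm ae] f'(1) by (simp add: integrable_completion)
    have "AE x in lborel. f' x = 0"
    proof (rule AE_eq_0_if_box_integrals_eq_0[OF f'i])
      fix u v
      define l where "l = (\<Sum>i\<in>Basis. max (a \<bullet> i) (u \<bullet> i) *\<^sub>R i)"
      define r where "r = (\<Sum>i\<in>Basis. min (b \<bullet> i) (v \<bullet> i) *\<^sub>R i)"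
      have lr: "box a b \<inter> box u v = box l r" unfolding l_def r_def by (rule box_Int_box)
      have "cbox l r = cbox a b \<inter> cbox u v" unfolding l_def r_def by (rule Int_interval[symmetric])
      then have "cbox l r \<subseteq> \<Omega>" using ab by auto
      then have "0 = (\<integral>x. d x * indicator (box l r) x \<partial>lebesgue_on \<Omega>)"
        using integral_box_eq_0[OF \<Omega> d zero] by simp
      also have "\<dots> = (\<integral>x. (if x \<in> \<Omega> then d x * indicator (box l r) x else 0) \<partial>lebesgue)"
        using \<Omega>s by (intro Lebesgue_Measure.integral_restrict_UNIV[symmetric])
      also have "\<dots> = (\<integral>x. f x * indicator (box u v) x \<partial>lebesgue)"
        by (intro Bochner_Integration.integral_cong) (auto simp: f_def indicator_def simp flip: lr)
      also have "\<dots> = (\<integral>x. f' x * indicator (box u v) x \<partial>lebesgue)"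
        using ae fm f'm by (intro integral_cong_AE) (auto simp: lborelD intro!: borel_measurable_times borel_measurable_indicator)
      also have "\<dots> = (\<integral>x. f' x * indicator (box u v) x \<partial>lborel)"
        using f'(1) by (intro integral_completion) auto
      finally show "(\<integral>x. f' x * indicator (box u v) x \<partial>lborel) = 0" by simp
    qed
    with f'(2) have "AE x in lborel. f x = 0" by eventually_elim simp
    then show ?thesis
      by eventually_elim (use sub in \<open>auto simp: f_def indicator_def split: if_splits\<close>)
  qed
  obtain \<D> where \<D>: "countable \<D>" "\<D> \<subseteq> Pow \<Omega>" "\<And>X. X \<in> \<D> \<Longrightarrow> \<exists>a b. X = cbox a b" "\<Union>\<D> = \<Omega>"
    using open_countable_Union_open_cbox[OF \<Omega>] by blast
  have "AE x in lborel. x \<in> X \<longrightarrow> d x = 0" if X\<D>: "X \<in> \<D>" for X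
  proof -
    obtain a b where X: "X = cbox a b" using \<D>(3)[OF X\<D>] by auto
    have "cbox a b - box a b \<in> null_sets lborel"
      by (simp add: null_sets_def emeasure_lborel_box_eq emeasure_lborel_cbox_eq emeasure_Diff box_subset_cbox)
    then have "AE x in lborel. x \<notin> cbox a b - box a b" by (rule AE_not_in)
    moreover have "AE x in lborel. x \<in> box a b \<longrightarrow> d x = 0"
      using \<D>(2) X\<D> X by (intro box_0) auto
    ultimately show ?thesis unfolding X by eventually_elim auto
  qed
  then have "AE x in lborel. \<forall>X\<in>\<D>. x \<in> X \<longrightarrow> d x = 0"
    unfolding AE_ball_countable[OF \<D>(1)] by blast
  then have "AE x in lebesgue. x \<in> \<Omega> \<longrightarrow> d x = 0"
    unfolding AE_completion_iff by eventually_elim (use \<D>(4) in auto)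
  then show ?thesis using \<Omega>s by (simp add: AE_restrict_space_iff)
qed

lemma integrable_mult_continuous:
  fixes f g :: "'a::euclidean_space \<Rightarrow> real"
  assumes \<Omega>: "open \<Omega>" "bounded \<Omega>" and f: "integrable (lebesgue_on \<Omega>) f"
    and g: "continuous_on (closure \<Omega>) g"
  shows "integrable (lebesgue_on \<Omega>) (\<lambda>x. f x * g x)"
proof -
  have [measurable]: "f \<in> borel_measurable (lebesgue_on \<Omega>)" using f by simp
  have [measurable]: "g \<in> borel_measurable (lebesgue_on \<Omega>)"
    using g \<Omega>(1) closure_subset
    by (intro continuous_imp_measurable_on_sets_lebesgue) (auto simp: lborelD intro: continuous_on_subset)
  have "compact (g ` closure \<Omega>)"
    using \<Omega> g by (intro compact_continuous_image) auto
  then obtain B where "\<And>y. y \<in> g ` closure \<Omega> \<Longrightarrow> norm y \<le> B"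
    by (meson bounded_iff compact_imp_bounded)
  then have B: "\<bar>g x\<bar> \<le> B" if "x \<in> \<Omega>" for x
    using that closure_subset[of \<Omega>] by auto
  have "integrable (lebesgue_on \<Omega>) (\<lambda>x. \<bar>f x\<bar> * B)"
    using f by simp
  then show ?thesis
  proof (rule Bochner_Integration.integrable_bound)
    show "AE x in lebesgue_on \<Omega>. norm (f x * g x) \<le> norm (\<bar>f x\<bar> * B)"
      using B by (intro AE_I2) (auto simp: abs_mult intro!: mult_left_mono order_trans[OF B abs_ge_self])
  qed measurable
qed

lemma square_integrable_component_integrable:
  fixes f :: "real^'n \<Rightarrow> real^'m" and G :: "real^'n \<Rightarrow> real^'n^'m"
  assumes "open \<Omega>" "bounded \<Omega>"
  shows "square_integrable (lebesgue_on \<Omega>) f \<Longrightarrow> integrable (lebesgue_on \<Omega>) (\<lambda>x. f x $ i)"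
    and "square_integrable (lebesgue_on \<Omega>) G \<Longrightarrow> integrable (lebesgue_on \<Omega>) (\<lambda>x. G x $ i $ j)"
proof -
  interpret finite_measure "lebesgue_on \<Omega>"
    using assms by (intro finite_measure_lebesgue_on bounded_set_imp_lmeasurable) (auto simp: lborelD)
  show "integrable (lebesgue_on \<Omega>) (\<lambda>x. f x $ i)" if "square_integrable (lebesgue_on \<Omega>) f"
    using integrable_bounded_linear[OF bounded_linear_vec_nth square_integrable_integrable[OF that]] .
  show "integrable (lebesgue_on \<Omega>) (\<lambda>x. G x $ i $ j)" if "square_integrable (lebesgue_on \<Omega>) G"
    using integrable_bounded_linear[OF bounded_linear_vec_nth
        integrable_bounded_linear[OF bounded_linear_vec_nth square_integrable_integrable[OF that]]] .
qed

lemma has_weak_grad_diff: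
  fixes f :: "real^'n \<Rightarrow> real^'m"
  assumes \<Omega>: "open \<Omega>" "bounded \<Omega>"
    and f: "has_weak_grad \<Omega> f F" and g: "has_weak_grad \<Omega> g G"
  shows "has_weak_grad \<Omega> (\<lambda>x. f x - g x) (\<lambda>x. F x - G x)"
  unfolding has_weak_grad_def
proof (intro conjI allI impI)
  have sq: "square_integrable (lebesgue_on \<Omega>) f" "square_integrable (lebesgue_on \<Omega>) F"
      "square_integrable (lebesgue_on \<Omega>) g" "square_integrable (lebesgue_on \<Omega>) G"
    using f g by (auto simp: has_weak_grad_def)
  show "square_integrable (lebesgue_on \<Omega>) (\<lambda>x. f x - g x)"
      "square_integrable (lebesgue_on \<Omega>) (\<lambda>x. F x - G x)"
    using sq by (auto intro: square_integrable_diff)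
  fix \<phi> :: "real^'n \<Rightarrow> real" and i j
  assume \<phi>: "\<phi> \<in> test_functions \<Omega>"
  let ?D = "\<lambda>x. frechet_derivative \<phi> (at x) (axis j 1)"
  have "axis j 1 \<in> (Basis :: (real^'n) set)" by (simp add: axis_in_Basis_iff)
  note c = test_function_C1(2)[OF \<phi> this] test_function_C1(3)[OF \<phi>]
  have c: "continuous_on (closure \<Omega>) ?D" "continuous_on (closure \<Omega>) \<phi>"
    using c by (auto intro: continuous_on_subset)
  have "integrable (lebesgue_on \<Omega>) (\<lambda>x. f x $ i * ?D x)" "integrable (lebesgue_on \<Omega>) (\<lambda>x. g x $ i * ?D x)"
      "integrable (lebesgue_on \<Omega>) (\<lambda>x. F x $ i $ j * \<phi> x)" "integrable (lebesgue_on \<Omega>) (\<lambda>x. G x $ i $ j * \<phi> x)"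
    using \<Omega> sq c by (auto intro!: integrable_mult_continuous square_integrable_component_integrable)
  moreover have "(\<integral>x. f x $ i * ?D x \<partial>lebesgue_on \<Omega>) = - (\<integral>x. F x $ i $ j * \<phi> x \<partial>lebesgue_on \<Omega>)"
      "(\<integral>x. g x $ i * ?D x \<partial>lebesgue_on \<Omega>) = - (\<integral>x. G x $ i $ j * \<phi> x \<partial>lebesgue_on \<Omega>)"
    using f g \<phi> by (auto simp: has_weak_grad_def)
  ultimately show "(\<integral>x. (f x - g x) $ i * ?D x \<partial>lebesgue_on \<Omega>)
      = - (\<integral>x. (F x - G x) $ i $ j * \<phi> x \<partial>lebesgue_on \<Omega>)"
    by (simp add: left_diff_distrib)
qed

lemma has_weak_grad_unique:
  fixes f :: "real^'n \<Rightarrow> real^'m"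
  assumes \<Omega>: "open \<Omega>" "bounded \<Omega>"
    and F: "has_weak_grad \<Omega> f F" and G: "has_weak_grad \<Omega> f G"
  shows "AE x in lebesgue_on \<Omega>. F x = G x"
proof -
  have D: "has_weak_grad \<Omega> (\<lambda>x. f x - f x) (\<lambda>x. F x - G x)"
    using has_weak_grad_diff[OF \<Omega> F G] .
  have "AE x in lebesgue_on \<Omega>. (F x - G x) $ i $ j = 0" for i j
  proof (rule AE_eq_0_if_test_integrals_eq_0[OF \<Omega>(1)])
    show "integrable (lebesgue_on \<Omega>) (\<lambda>x. (F x - G x) $ i $ j)"
      using D \<Omega> by (auto simp only: has_weak_grad_def intro: square_integrable_component_integrable)
    fix \<phi> :: "real^'n \<Rightarrow> real"
    assume "\<phi> \<in> test_functions \<Omega>"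
    with D have "(\<integral>x. (f x - f x) $ i * frechet_derivative \<phi> (at x) (axis j 1) \<partial>lebesgue_on \<Omega>)
        = - (\<integral>x. (F x - G x) $ i $ j * \<phi> x \<partial>lebesgue_on \<Omega>)"
      unfolding has_weak_grad_def by blast
    then show "(\<integral>x. (F x - G x) $ i $ j * \<phi> x \<partial>lebesgue_on \<Omega>) = 0"
      by simp
  qed
  then have "AE x in lebesgue_on \<Omega>. \<forall>i j. (F x - G x) $ i $ j = 0"
    unfolding AE_all_countable by blast
  then show ?thesis by eventually_elim (simp add: vec_eq_iff)
qed

lemma has_weak_grad_weak_grad:
  "f \<in> W12 \<Omega> \<Longrightarrow> has_weak_grad \<Omega> f (weak_grad \<Omega> f)"
  unfolding W12_def weak_grad_def by (simp add: someI_ex)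

text \<open>
  \<^const>\<open>weak_grad\<close> is a choice among all weak gradients, so this is what makes it computable: any
  weak gradient that is known explicitly may be used in its place.
\<close>
lemma weak_grad_AE_eq:
  fixes f :: "real^'n \<Rightarrow> real^'m"
  assumes "open \<Omega>" "bounded \<Omega>" "has_weak_grad \<Omega> f G"
  shows "AE x in lebesgue_on \<Omega>. weak_grad \<Omega> f x = G x"
  using assms by (intro has_weak_grad_unique[OF assms(1,2) has_weak_grad_weak_grad])
    (auto simp: W12_def)

section \<open>Polar coordinates and the divergence theorem on the annulus\<close>

lemma circle_point_nth [simp]: "circle_point r t $ 1 = r * cos t" "circle_point r t $ 2 = r * sin t"
  by (simp_all add: circle_point_def)

lemma circle_point_eq_scaleR: "circle_point r t = r *\<^sub>R circle_point 1 t"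
  by (simp add: vec_eq_iff forall_2)

lemma norm_circle_point [simp]: "norm (circle_point r t) = \<bar>r\<bar>"
proof -
  have "(norm (circle_point r t))\<^sup>2 = r\<^sup>2"
    by (simp add: power2_norm_eq_inner inner_vec_def sum_2)
       (simp add: algebra_simps flip: distrib_left power2_eq_square)
  then show ?thesis by (metis abs_norm_cancel power2_eq_iff_nonneg real_sqrt_abs)
qed

lemma circle_point_eqD:
  assumes "circle_point r t = circle_point s u" "0 < r" "0 < s" "0 \<le> t" "t < 2 * pi" "0 \<le> u" "u < 2 * pi"
  shows "r = s \<and> t = u"
proof -
  have rs: "r = s" using arg_cong[OF assms(1), of norm] assms(2,3) by simp
  have "sin t = sin u \<and> cos t = cos u"
    using arg_cong[OF assms(1), of "\<lambda>x. x $ 1"] arg_cong[OF assms(1), of "\<lambda>x. x $ 2"] assms(2) rs by simp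
  then obtain n :: int where n: "t = u + 2 * pi * n" by (metis sin_cos_eq_iff mult.commute)
  have "2 * pi * real_of_int n < 2 * pi * 1" "2 * pi * - 1 < 2 * pi * real_of_int n"
    using n assms by linarith+
  then have "real_of_int n < 1" "- 1 < real_of_int n"
    by (simp_all only: mult_less_cancel_left_pos[of "2 * pi"] pi_gt_zero zero_less_mult_iff
        zero_less_numeral simp_thms)
  then have "n = 0" by linarith
  with n rs show ?thesis by simp
qed

lemma polar_coordinates_surj:
  fixes x :: "real^2"
  obtains t where "0 \<le> t" "t < 2 * pi" "x = circle_point (norm x) t"
proof (cases "x = 0")
  case True
  then show ?thesis by (intro that[of 0]) (auto simp: vec_eq_iff forall_2)
next
  case False
  have "(x $ 1 / norm x)\<^sup>2 + (x $ 2 / norm x)\<^sup>2 = (x \<bullet> x) / (norm x)\<^sup>2"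
    by (simp add: inner_vec_def sum_2 power_divide add_divide_distrib power2_eq_square)
  also have "\<dots> = 1" using False by (simp add: dot_square_norm)
  finally obtain t where t: "0 \<le> t" "t < 2 * pi" "x $ 1 / norm x = cos t" "x $ 2 / norm x = sin t"
    by (rule sincos_total_2pi)
  have "x = circle_point (norm x) t"
    unfolding vec_eq_iff forall_2 circle_point_nth t(3,4)[symmetric] using False by simp
  with t show ?thesis by (intro that)
qed

lemma open_annulus: "open (annulus R1 R2)"
  unfolding annulus_def by (intro open_Collect_conj open_Collect_less continuous_intros)

lemma bounded_annulus: "bounded (annulus R1 R2)"
  by (rule bounded_subset[of "cball 0 R2"]) (auto simp: annulus_def)

definition closed_annulus :: "real \<Rightarrow> real \<Rightarrow> (real ^ 2) set" where
  "closed_annulus R1 R2 = {x. R1 \<le> norm x \<and> norm x \<le> R2}"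

lemma closure_annulus_subset: "closure (annulus R1 R2) \<subseteq> closed_annulus R1 R2"
proof (rule closure_minimal)
  show "closed (closed_annulus R1 R2)"
    unfolding closed_annulus_def by (intro closed_Collect_conj closed_Collect_le continuous_intros)
qed (auto simp: annulus_def closed_annulus_def)

lemma continuous_on_vector2 [continuous_intros]:
  fixes f g :: "'a::t2_space \<Rightarrow> real"
  assumes "continuous_on S f" "continuous_on S g"
  shows "continuous_on S (\<lambda>x. vector [f x, g x] :: real^2)"
proof -
  have eq: "(vector [a, b] :: real^2) = (\<chi> i. if i = 1 then a else b)" for a b :: real
    by (simp add: vec_eq_iff forall_2)
  show ?thesis
    unfolding eq
  proof (rule continuous_on_vec_lambda)
    show "continuous_on S (\<lambda>x. if i = (1::2) then f x else g x)" for i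
      using assms by (cases "i = 1") auto
  qed
qed

lemma continuous_on_circle_point [continuous_intros]:
  fixes f g :: "'a::t2_space \<Rightarrow> real"
  shows "continuous_on S f \<Longrightarrow> continuous_on S g \<Longrightarrow> continuous_on S (\<lambda>x. circle_point (f x) (g x))"
  unfolding circle_point_def by (intro continuous_intros continuous_on_cos continuous_on_sin)

text \<open>Fubini's theorem for pairs, carried over to vectors by a content-preserving bijection.\<close>
lemma integral_cbox_vec2:
  fixes f :: "real^2 \<Rightarrow> real"
  assumes f: "continuous_on (cbox (vector [a, c]) (vector [b, d])) f"
  shows "integral (cbox (vector [a, c]) (vector [b, d])) f
    = integral {a..b} (\<lambda>x. integral {c..d} (\<lambda>y. f (vector [x, y])))"
proof -
  let ?g = "\<lambda>p::real \<times> real. vector [fst p, snd p] :: real^2" and ?h = "\<lambda>x::real^2. (x $ 1, x $ 2)"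
  have ub: "cbox u v = {fst u..fst v} \<times> {snd u..snd v}" for u v :: "real \<times> real"
    by (cases u, cases v) (simp add: cbox_Pair_eq)
  have g_box: "?g ` cbox u v = cbox (?g u) (?g v)" for u v
  proof (intro equalityI subsetI)
    fix x assume "x \<in> cbox (?g u) (?g v)"
    then show "x \<in> ?g ` cbox u v"
      by (intro image_eqI[of _ _ "?h x"]) (auto simp: mem_box_cart forall_2 vec_eq_iff ub)
  qed (auto simp: mem_box_cart forall_2 ub)
  have h_box: "?h ` cbox u v = cbox (?h u) (?h v)" for u v
  proof -
    have "cbox u v = ?g ` cbox (?h u) (?h v)"
      unfolding g_box by (intro arg_cong2[where f=cbox]) (auto simp: vec_eq_iff forall_2)
    then show ?thesis by (auto simp: image_image)
  qed
  have cg: "continuous_on S ?g" for S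
    by (intro continuous_intros)
  have "((\<lambda>p. f (?g p)) has_integral (1 / 1) *\<^sub>R integral (cbox (vector [a, c]) (vector [b, d])) f)
      (?h ` cbox (vector [a, c]) (vector [b, d]))"
  proof (rule has_integral_twiddle)
    show "continuous (at x) ?g" for x
      using cg[of UNIV] unfolding continuous_on_eq_continuous_at[OF open_UNIV] by (rule bspec) simp
    show "measure lborel (?g ` cbox u v) = 1 * measure lborel (cbox u v)" for u v
    proof (cases "cbox u v = {}")
      case False
      then have "fst u \<le> fst v" "snd u \<le> snd v"
        by (auto simp: ub)
      moreover from this have "cbox (?g u) (?g v) \<noteq> {}"
        by (simp add: interval_ne_empty_cart forall_2)
      ultimately show ?thesis unfolding g_box
        by (cases u, cases v) (simp add: content_cbox_cart content_Pair UNIV_2)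
    qed simp
    show "(f has_integral integral (cbox (vector [a, c]) (vector [b, d])) f) (cbox (vector [a, c]) (vector [b, d]))"
      using integrable_continuous[OF f] by (rule integrable_integral)
  qed (auto simp: g_box h_box vec_eq_iff forall_2 intro!: exI)
  then have "integral (cbox (vector [a, c]) (vector [b, d])) f = integral (cbox (a, c) (b, d)) (\<lambda>p. f (?g p))"
    by (simp add: h_box integral_unique)
  also have "\<dots> = integral (cbox a b) (\<lambda>x. integral (cbox c d) (\<lambda>y. f (?g (x, y))))"
  proof (rule integral_prod_continuous)
    show "continuous_on (cbox (a, c) (b, d)) (\<lambda>p. f (?g p))"
      by (rule continuous_on_compose2[OF f cg]) (simp add: g_box)
  qed
  finally show ?thesis by simp
qed

text \<open>
  Polar coordinates are injective on the half-open rectangle \<open>S\<close>, which differs from its closure by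
  a null set; there the integrand is continuous and Fubini's theorem applies.
\<close>
lemma integral_annulus_polar:
  fixes f :: "real^2 \<Rightarrow> real"
  assumes R: "0 < R1" "R1 < R2" and f: "continuous_on (closed_annulus R1 R2) f"
  shows "(\<integral>x. f x \<partial>lebesgue_on (annulus R1 R2))
    = integral {R1..R2} (\<lambda>r. integral {0..2 * pi} (\<lambda>t. r * f (circle_point r t)))"
proof -
  let ?a = "vector [R1, 0] :: real^2" and ?b = "vector [R2, 2 * pi] :: real^2"
  define S where "S = {x::real^2. R1 < x $ 1 \<and> x $ 1 < R2 \<and> 0 \<le> x $ 2 \<and> x $ 2 < 2 * pi}"
  let ?g = "\<lambda>x::real^2. circle_point (x $ 1) (x $ 2)"
  define g' where "g' = (\<lambda>(x :: real^2) (h :: real^2). vector [h $ 1 * cos (x $ 2) - x $ 1 * sin (x $ 2) * h $ 2,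
      h $ 1 * sin (x $ 2) + x $ 1 * cos (x $ 2) * h $ 2] :: real^2)"
  have der: "(?g has_derivative g' x) (at x within S)" for x :: "real^2"
  proof -
    have nth: "((\<lambda>x::real^2. x $ i) has_derivative (\<lambda>h. h $ i)) (at x within S)" for i
      using bounded_linear_imp_has_derivative[OF bounded_linear_vec_nth] .
    have "((\<lambda>y. ?g y $ 1) has_derivative (\<lambda>h. g' x h $ 1)) (at x within S)"
      unfolding circle_point_nth
      by (rule has_derivative_eq_rhs, rule has_derivative_mult[OF nth has_derivative_cos[OF nth]])
         (simp add: g'_def fun_eq_iff)
    moreover have "((\<lambda>y. ?g y $ 2) has_derivative (\<lambda>h. g' x h $ 2)) (at x within S)"
      unfolding circle_point_nth
      by (rule has_derivative_eq_rhs, rule has_derivative_mult[OF nth has_derivative_sin[OF nth]])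
         (simp add: g'_def fun_eq_iff)
    ultimately have "((\<lambda>y. ?g y $ i) has_derivative (\<lambda>h. g' x h $ i)) (at x within S)" for i
      using exhaust_2[of i] by auto
    then show ?thesis
      by (auto simp: has_derivative_componentwise_within[of ?g] Basis_vec_def inner_axis)
  qed
  have det: "det (matrix (g' x)) = x $ 1" for x
  proof -
    have "det (matrix (g' x)) = x $ 1 * (cos (x $ 2) * cos (x $ 2)) + x $ 1 * (sin (x $ 2) * sin (x $ 2))"
      by (simp add: det_2 matrix_def g'_def axis_def algebra_simps)
    also have "\<dots> = x $ 1 * ((cos (x $ 2))\<^sup>2 + (sin (x $ 2))\<^sup>2)"
      by (simp only: power2_eq_square distrib_left)
    finally show ?thesis by simp
  qed
  have image: "?g ` S = annulus R1 R2"
  proof (intro equalityI subsetI)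
    fix x assume x: "x \<in> annulus R1 R2"
    obtain t where t: "0 \<le> t" "t < 2 * pi" "x = circle_point (norm x) t"
      by (rule polar_coordinates_surj)
    with x show "x \<in> ?g ` S"
      by (intro image_eqI[of _ _ "vector [norm x, t]"]) (auto simp: S_def annulus_def)
  qed (use R in \<open>auto simp: S_def annulus_def\<close>)
  have inj: "inj_on ?g S"
  proof (rule inj_onI)
    fix x y assume "x \<in> S" "y \<in> S" "?g x = ?g y"
    then show "x = y"
      using circle_point_eqD[of "x $ 1" "x $ 2" "y $ 1" "y $ 2"] R
      by (auto simp: S_def vec_eq_iff forall_2)
  qed
  have S_sub: "S \<subseteq> cbox ?a ?b" and box_sub: "box ?a ?b \<subseteq> S"
    by (auto simp: S_def mem_box_cart forall_2)
  have S: "S \<in> sets lebesgue"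
  proof -
    have "S \<in> sets borel"
      unfolding S_def by measurable
    then show ?thesis by simp
  qed
  have circ: "circle_point r t \<in> closed_annulus R1 R2" if "R1 \<le> r" "r \<le> R2" for r t
    using that R by (simp add: closed_annulus_def)
  have cont: "continuous_on (cbox ?a ?b) (\<lambda>x. x $ 1 * f (?g x))"
    by (intro continuous_intros continuous_on_compose2[OF f])
       (auto intro!: continuous_intros circ simp: mem_box_cart forall_2)
  define F :: "real^2 \<Rightarrow> real^1" where "F = (\<lambda>x. vec (f x))"
  have F_int: "(\<lambda>x. \<bar>det (matrix (g' x))\<bar> *\<^sub>R F (?g x)) absolutely_integrable_on S"
  proof -
    have "continuous_on (cbox ?a ?b) (\<lambda>x. vec (x $ 1 * f (?g x)) :: real^1)"
      unfolding vec_def by (intro continuous_on_vec_lambda cont)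
    then have "(\<lambda>x. vec (x $ 1 * f (?g x)) :: real^1) absolutely_integrable_on cbox ?a ?b"
      by (rule absolutely_integrable_continuous)
    then have "(\<lambda>x. vec (x $ 1 * f (?g x)) :: real^1) absolutely_integrable_on S"
      by (rule set_integrable_subset) (use S S_sub in auto)
    then show ?thesis
      by (rule set_integrable_cong[THEN iffD1, rotated -1])
         (use R in \<open>auto simp: det F_def S_def vec_eq_iff\<close>)
  qed
  have "integral (?g ` S) F = integral S (\<lambda>x. \<bar>det (matrix (g' x))\<bar> *\<^sub>R F (?g x))"
    by (rule integral_change_of_variables[OF S der inj disjI2[OF F_int]])
  moreover have "F absolutely_integrable_on (?g ` S)"
    using F_int absolutely_integrable_change_of_variables[OF S der inj] by blast
  ultimately have "integral (?g ` S) (\<lambda>x. F x $ 1) = integral S (\<lambda>x. (\<bar>det (matrix (g' x))\<bar> *\<^sub>R F (?g x)) $ 1)"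
    by (simp only: integral_component_eq_cart[OF set_lebesgue_integral_eq_integral(1)] F_int)
  then have "integral (annulus R1 R2) f = integral S (\<lambda>x. \<bar>x $ 1\<bar> * f (?g x))"
    unfolding image by (simp add: F_def det)
  also have "\<dots> = integral S (\<lambda>x. x $ 1 * f (?g x))"
    using R by (intro integral_cong) (auto simp: S_def)
  also have "\<dots> = integral (cbox ?a ?b) (\<lambda>x. x $ 1 * f (?g x))"
  proof (rule integral_spike_set)
    have "negligible (cbox ?a ?b - S)"
      by (rule negligible_subset[OF negligible_frontier_interval]) (use box_sub in blast)
    then show "negligible {x \<in> cbox ?a ?b - S. x $ 1 * f (?g x) \<noteq> 0}"
      by (rule negligible_subset) blast
    show "negligible {x \<in> S - cbox ?a ?b. x $ 1 * f (?g x) \<noteq> 0}"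
      using S_sub by (intro negligible_subset[OF negligible_empty]) blast
  qed
  also have "\<dots> = integral {R1..R2} (\<lambda>r. integral {0..2 * pi} (\<lambda>t. r * f (circle_point r t)))"
    by (subst integral_cbox_vec2[OF cont]) simp
  finally show ?thesis
  proof (subst lebesgue_integral_eq_integral)
    have "integrable (lebesgue_on (annulus R1 R2)) (\<lambda>x. 1 * f x)"
      using R f closure_annulus_subset
      by (intro integrable_mult_continuous open_annulus bounded_annulus finite_measure.integrable_const
          finite_measure_lebesgue_on bounded_set_imp_lmeasurable)
         (auto simp: lborelD open_annulus intro: continuous_on_subset)
    then show "integrable (lebesgue_on (annulus R1 R2)) f" by simp
  qed (auto simp: lborelD open_annulus)
qed

lemma circle_point_axis: "circle_point r t = (r * cos t) *\<^sub>R axis 1 1 + (r * sin t) *\<^sub>R axis 2 1"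
  by (simp add: vec_eq_iff forall_2 axis_def)

text \<open>
  In polar coordinates, with the unit normal \<open>e\<close> and the unit tangent \<open>n\<close>, the divergence satisfies
  \<open>r div F = \<partial>\<^sub>r (r F \<cdot> e) + \<partial>\<^sub>t (F \<cdot> n)\<close>. The two terms are \<open>p\<close> and \<open>q\<close> in the proof: the second is the
  derivative of a periodic function of the angle, and the first is integrated over the radius.
\<close>
lemma divergence_theorem_annulus:
  fixes F :: "real^2 \<Rightarrow> real^2"
  assumes R: "0 < R1" "R1 < R2"
    and der: "\<And>x. x \<in> closed_annulus R1 R2 \<Longrightarrow> (F has_derivative F' x) (at x)"
    and cont: "\<And>j. continuous_on (closed_annulus R1 R2) (\<lambda>x. F' x (axis j 1))"
  shows "(\<integral>x. (\<Sum>i\<in>UNIV. F' x (axis i 1) $ i) \<partial>lebesgue_on (annulus R1 R2))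
    = integral {0..2 * pi} (\<lambda>t. R2 * (F (circle_point R2 t) \<bullet> circle_point 1 t))
    - integral {0..2 * pi} (\<lambda>t. R1 * (F (circle_point R1 t) \<bullet> circle_point 1 t))"
proof -
  let ?A = "closed_annulus R1 R2"
  define n :: "real \<Rightarrow> real^2" where "n = (\<lambda>t. (- sin t) *\<^sub>R axis 1 1 + cos t *\<^sub>R axis 2 1)"
  define a where "a = (\<lambda>j x. F' x (axis j 1))"
  define p where "p = (\<lambda>r t. F (circle_point r t) \<bullet> circle_point 1 t
      + r * ((cos t *\<^sub>R a 1 (circle_point r t) + sin t *\<^sub>R a 2 (circle_point r t)) \<bullet> circle_point 1 t))"
  define q where "q = (\<lambda>r t. r * ((- sin t *\<^sub>R a 1 (circle_point r t) + cos t *\<^sub>R a 2 (circle_point r t)) \<bullet> n t)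
      - F (circle_point r t) \<bullet> circle_point 1 t)"
  have circ: "circle_point r t \<in> ?A" if "R1 \<le> r" "r \<le> R2" for r t
    using that R by (simp add: closed_annulus_def)
  have F'_eq: "F' x (u *\<^sub>R axis 1 1 + v *\<^sub>R axis 2 1) = u *\<^sub>R a 1 x + v *\<^sub>R a 2 x" if "x \<in> ?A" for x u v
    using has_derivative_linear[OF der[OF that]] by (simp add: a_def linear_add linear_scale)
  have cF: "continuous_on ?A F"
    by (meson der continuous_at_imp_continuous_on has_derivative_continuous)
  have ca: "continuous_on ?A (a j)" for j
    unfolding a_def by (rule cont)
  have cpq: "continuous_on (cbox (R1, 0) (R2, 2 * pi)) (\<lambda>(r, t). p r t)"
      "continuous_on (cbox (R1, 0) (R2, 2 * pi)) (\<lambda>(r, t). q r t)"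
    unfolding p_def q_def n_def case_prod_unfold
    by (auto intro!: continuous_intros continuous_on_compose2[OF cF] continuous_on_compose2[OF ca]
        continuous_on_cos continuous_on_sin circ simp: cbox_Pair_eq)
  have cP: "continuous_on {0..2 * pi} (Pair r)" for r :: real
    using continuous_on_Pair[of "{0..2 * pi}" "\<lambda>_. r" "\<lambda>t. t"] by simp
  have pq_int: "p r integrable_on {0..2 * pi}" "q r integrable_on {0..2 * pi}" if "R1 \<le> r" "r \<le> R2" for r
  proof -
    have "Pair r ` {0..2 * pi} \<subseteq> cbox (R1, 0) (R2, 2 * pi)" using that by (auto simp: cbox_Pair_eq)
    note sub = continuous_on_compose2[OF _ cP this]
    show "p r integrable_on {0..2 * pi}" "q r integrable_on {0..2 * pi}"
      using sub[OF cpq(1)] sub[OF cpq(2)] by (auto intro!: integrable_continuous_real)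
  qed
  have der_t: "((\<lambda>t. F (circle_point r t) \<bullet> n t) has_vector_derivative q r t) (at t within {0..2 * pi})"
    if "R1 \<le> r" "r \<le> R2" for r t
  proof -
    have "((\<lambda>t. circle_point r t) has_vector_derivative (- (r * sin t)) *\<^sub>R axis 1 1 + (r * cos t) *\<^sub>R axis 2 1)
        (at t within {0..2 * pi})"
      unfolding circle_point_axis by (auto intro!: derivative_eq_intros simp: has_vector_derivative_def algebra_simps)
    from vector_derivative_diff_chain_within[OF this has_derivative_at_withinI[OF der[OF circ[OF that]]]]
    have "((\<lambda>t. F (circle_point r t)) has_vector_derivative
        (- (r * sin t)) *\<^sub>R a 1 (circle_point r t) + (r * cos t) *\<^sub>R a 2 (circle_point r t)) (at t within {0..2 * pi})"
      by (simp only: o_def F'_eq[OF circ[OF that]])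
    moreover have "(n has_vector_derivative - circle_point 1 t) (at t within {0..2 * pi})"
      unfolding n_def circle_point_axis
      by (auto intro!: derivative_eq_intros simp: has_vector_derivative_def algebra_simps)
    ultimately have "((\<lambda>t. F (circle_point r t) \<bullet> n t) has_vector_derivative
        F (circle_point r t) \<bullet> (- circle_point 1 t)
        + ((- (r * sin t)) *\<^sub>R a 1 (circle_point r t) + (r * cos t) *\<^sub>R a 2 (circle_point r t)) \<bullet> n t) (at t within {0..2 * pi})"
      by (rule bounded_bilinear.has_vector_derivative[OF bounded_bilinear_inner])
    then show ?thesis
      by (rule has_vector_derivative_eq_rhs) (simp add: q_def inner_add_left inner_diff_left algebra_simps)
  qed
  have q_int: "integral {0..2 * pi} (q r) = 0" if "R1 \<le> r" "r \<le> R2" for r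
  proof -
    have "(q r has_integral F (circle_point r (2 * pi)) \<bullet> n (2 * pi) - F (circle_point r 0) \<bullet> n 0) {0..2 * pi}"
      by (rule fundamental_theorem_of_calculus) (use der_t[OF that] in auto)
    moreover have "circle_point r (2 * pi) = circle_point r 0" "n (2 * pi) = n 0"
      by (simp_all add: circle_point_axis n_def)
    ultimately show ?thesis by (simp add: integral_unique)
  qed
  have p_int: "integral {R1..R2} (\<lambda>r. p r t)
      = R2 * (F (circle_point R2 t) \<bullet> circle_point 1 t) - R1 * (F (circle_point R1 t) \<bullet> circle_point 1 t)" for t
  proof (rule integral_unique, rule fundamental_theorem_of_calculus)
    fix r assume "r \<in> {R1..R2}"
    then have r: "R1 \<le> r" "r \<le> R2" by auto
    have "((\<lambda>r. circle_point r t) has_vector_derivative cos t *\<^sub>R axis 1 1 + sin t *\<^sub>R axis 2 1)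
        (at r within {R1..R2})"
      unfolding circle_point_axis by (auto intro!: derivative_eq_intros simp: has_vector_derivative_def algebra_simps)
    from vector_derivative_diff_chain_within[OF this has_derivative_at_withinI[OF der[OF circ[OF r]]]]
    have "((\<lambda>r. F (circle_point r t)) has_vector_derivative
        cos t *\<^sub>R a 1 (circle_point r t) + sin t *\<^sub>R a 2 (circle_point r t)) (at r within {R1..R2})"
      by (simp only: o_def F'_eq[OF circ[OF r]])
    then have "((\<lambda>r. F (circle_point r t) \<bullet> circle_point 1 t) has_vector_derivative
        (cos t *\<^sub>R a 1 (circle_point r t) + sin t *\<^sub>R a 2 (circle_point r t)) \<bullet> circle_point 1 t) (at r within {R1..R2})"
      by (rule bounded_linear.has_vector_derivative[OF bounded_linear_inner_left])
    then have "((\<lambda>r. F (circle_point r t) \<bullet> circle_point 1 t) has_real_derivative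
        (cos t *\<^sub>R a 1 (circle_point r t) + sin t *\<^sub>R a 2 (circle_point r t)) \<bullet> circle_point 1 t) (at r within {R1..R2})"
      by (simp only: has_real_derivative_iff_has_vector_derivative)
    from DERIV_mult[OF DERIV_ident this]
    show "((\<lambda>r. r * (F (circle_point r t) \<bullet> circle_point 1 t)) has_vector_derivative p r t) (at r within {R1..R2})"
      by (simp add: p_def has_real_derivative_iff_has_vector_derivative mult.commute)
  qed (use R in auto)
  have sum_pq: "r * (\<Sum>i\<in>UNIV. F' (circle_point r t) (axis i 1) $ i) = p r t + q r t" for r t
  proof -
    have "p r t + q r t = r * ((a 1 (circle_point r t) $ 1 + a 2 (circle_point r t) $ 2) * ((cos t)\<^sup>2 + (sin t)\<^sup>2))"
      unfolding p_def q_def n_def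
      by (simp add: inner_vec_def sum_2 axis_def power2_eq_square algebra_simps del: sin_cos_squared_add sin_cos_squared_add2 sin_cos_squared_add3)
    then show ?thesis by (simp add: a_def sum_2)
  qed
  have "continuous_on ?A (\<lambda>x. \<Sum>i\<in>UNIV. F' x (axis i 1) $ i)"
    by (intro continuous_intros cont)
  then have "(\<integral>x. (\<Sum>i\<in>UNIV. F' x (axis i 1) $ i) \<partial>lebesgue_on (annulus R1 R2))
      = integral {R1..R2} (\<lambda>r. integral {0..2 * pi} (\<lambda>t. r * (\<Sum>i\<in>UNIV. F' (circle_point r t) (axis i 1) $ i)))"
    using R by (intro integral_annulus_polar)
  also have "\<dots> = integral {R1..R2} (\<lambda>r. integral {0..2 * pi} (p r))"
    unfolding sum_pq
  proof (rule Henstock_Kurzweil_Integration.integral_cong)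
    fix r assume "r \<in> {R1..R2}"
    then show "integral {0..2 * pi} (\<lambda>t. p r t + q r t) = integral {0..2 * pi} (p r)"
      using Henstock_Kurzweil_Integration.integral_add[OF pq_int[of r]] q_int[of r] by simp
  qed
  also have "\<dots> = integral {0..2 * pi} (\<lambda>t. integral {R1..R2} (\<lambda>r. p r t))"
    using integral_swap_continuous[OF cpq(1)] by simp
  also have "\<dots> = integral {0..2 * pi} (\<lambda>t. R2 * (F (circle_point R2 t) \<bullet> circle_point 1 t)
      - R1 * (F (circle_point R1 t) \<bullet> circle_point 1 t))"
    unfolding p_int ..
  also have "\<dots> = integral {0..2 * pi} (\<lambda>t. R2 * (F (circle_point R2 t) \<bullet> circle_point 1 t))
    - integral {0..2 * pi} (\<lambda>t. R1 * (F (circle_point R1 t) \<bullet> circle_point 1 t))"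
    using R by (intro Henstock_Kurzweil_Integration.integral_diff integrable_continuous_real)
       (auto intro!: continuous_intros continuous_on_compose2[OF cF] circ)
  finally show ?thesis .
qed

lemma inj_on_circle_point: "0 < r \<Longrightarrow> inj_on (circle_point r) {0..<2 * pi}"
  using circle_point_eqD[of r _ r] by (auto intro!: inj_onI)

text \<open>
  The parametrization is injective on the half-open interval of angles, so that embedding the angular
  measure agrees with pushing it forward; integrals over the circle thereby become integrals over angles.
\<close>
lemma circle_measure_eq_distr:
  assumes "0 < r"
  shows "circle_measure r = distr (density (lebesgue_on {0..<2 * pi}) (\<lambda>_. ennreal r)) (circle_measure r) (circle_point r)"
  unfolding circle_measure_def
  by (rule embed_measure_eq_distr') (use inj_on_circle_point[OF assms] in simp)

lemma measurable_circle_point: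
  assumes "0 < r"
  shows "circle_point r \<in> measurable (density (lebesgue_on {0..<2 * pi}) (\<lambda>_. ennreal r)) (circle_measure r)"
  unfolding circle_measure_def
  by (rule measurable_embed_measure2') (use inj_on_circle_point[OF assms] in simp)

lemma finite_measure_circle: assumes "0 < r" shows "finite_measure (circle_measure r)"
proof -
  have "{0..<2 * pi} \<in> lmeasurable" by (simp add: bounded_set_imp_lmeasurable)
  then interpret finite_measure "lebesgue_on {0..<2 * pi}" by (rule finite_measure_lebesgue_on)
  have "finite_measure (density (lebesgue_on {0..<2 * pi}) (\<lambda>_. ennreal r))"
    by (rule finite_measureI)
       (simp add: emeasure_density nn_integral_cmult_indicator ennreal_mult_eq_top_iff emeasure_finite)
  then show ?thesis
    by (subst circle_measure_eq_distr[OF assms])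
       (rule finite_measure.finite_measure_distr[OF _ measurable_circle_point[OF assms]])
qed

lemma borel_measurable_circle_continuous:
  fixes h :: "real^2 \<Rightarrow> 'b::euclidean_space"
  assumes "continuous_on UNIV h"
  shows "h \<in> borel_measurable (circle_measure r)"
  unfolding circle_measure_def
proof (rule measurable_embed_measure1)
  have "continuous_on UNIV (\<lambda>t. h (circle_point r t))"
    by (intro continuous_on_compose2[OF assms] continuous_intros) auto
  then have "(\<lambda>t. h (circle_point r t)) \<in> borel_measurable (lebesgue_on {0..<2 * pi})"
    by (intro continuous_imp_measurable_on_sets_lebesgue) (auto intro: continuous_on_subset)
  then show "(\<lambda>t. h (circle_point r t)) \<in> borel_measurable (density (lebesgue_on {0..<2 * pi}) (\<lambda>_. ennreal r))"
    by simp
qed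

lemma AE_circle_norm: "0 < r \<Longrightarrow> AE x in circle_measure r. norm x = r"
  by (rule AE_I2) (auto simp: circle_measure_def space_embed_measure)

lemma square_integrable_circle_continuous:
  fixes h :: "real^2 \<Rightarrow> 'b::euclidean_space"
  assumes r: "0 < r" and h: "continuous_on UNIV h"
  shows "square_integrable (circle_measure r) h"
proof -
  interpret finite_measure "circle_measure r" using r by (rule finite_measure_circle)
  have [measurable]: "h \<in> borel_measurable (circle_measure r)"
    using h by (rule borel_measurable_circle_continuous)
  have "compact (h ` cball 0 r)"
    using h by (intro compact_continuous_image) (auto intro: continuous_on_subset)
  then obtain B where "\<And>y. y \<in> h ` cball 0 r \<Longrightarrow> norm y \<le> B"
    by (meson bounded_iff compact_imp_bounded)
  then have B: "norm (h x) \<le> B" if "norm x = r" for x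
    using that by auto
  from AE_circle_norm[OF r] have "AE x in circle_measure r. norm ((norm (h x))\<^sup>2) \<le> B\<^sup>2"
    by eventually_elim (auto intro!: power_mono B)
  then have "integrable (circle_measure r) (\<lambda>x. (norm (h x))\<^sup>2)"
    by (rule integrable_const_bound) measurable
  then show ?thesis by (auto simp: square_integrable_def)
qed

lemma integral_circle_continuous:
  fixes h :: "real^2 \<Rightarrow> real"
  assumes r: "0 < r" and h: "continuous_on UNIV h"
  shows "(\<integral>x. h x \<partial>circle_measure r) = integral {0..2 * pi} (\<lambda>t. r * h (circle_point r t))"
proof -
  have hm: "h \<in> borel_measurable (circle_measure r)" using h by (rule borel_measurable_circle_continuous)
  have c: "continuous_on UNIV (\<lambda>t. h (circle_point r t))"
    by (intro continuous_on_compose2[OF h] continuous_intros) auto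
  then have cm: "(\<lambda>t. h (circle_point r t)) \<in> borel_measurable (lebesgue_on {0..<2 * pi})"
    by (intro continuous_imp_measurable_on_sets_lebesgue) (auto intro: continuous_on_subset)
  have "(\<integral>x. h x \<partial>circle_measure r)
      = (\<integral>t. h (circle_point r t) \<partial>density (lebesgue_on {0..<2 * pi}) (\<lambda>_. ennreal r))"
    by (subst circle_measure_eq_distr[OF r], subst integral_distr[OF measurable_circle_point[OF r] hm]) simp
  also have "\<dots> = (\<integral>t. r * h (circle_point r t) \<partial>lebesgue_on {0..<2 * pi})"
    using r cm by (subst integral_density) auto
  also have "\<dots> = integral {0..<2 * pi} (\<lambda>t. r * h (circle_point r t))"
  proof (rule lebesgue_integral_eq_integral)
    have "(\<lambda>t. h (circle_point r t)) absolutely_integrable_on {0..2 * pi}"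
      by (intro absolutely_integrable_continuous_real continuous_intros continuous_on_subset[OF c]) auto
    then have "(\<lambda>t. h (circle_point r t)) absolutely_integrable_on {0..<2 * pi}"
      by (rule set_integrable_subset) auto
    then have "integrable (lebesgue_on {0..<2 * pi}) (\<lambda>t. h (circle_point r t))"
      by (simp add: integrable_restrict_space set_integrable_def)
    then show "integrable (lebesgue_on {0..<2 * pi}) (\<lambda>t. r * h (circle_point r t))"
      by (rule integrable_mult_right)
  qed auto
  also have "\<dots> = integral {0..2 * pi} (\<lambda>t. r * h (circle_point r t))"
  proof (rule integral_spike_set)
    have "negligible {2 * pi}" by simp
    then show "negligible {t \<in> {0..2 * pi} - {0..<2 * pi}. r * h (circle_point r t) \<noteq> 0}"
      by (rule negligible_subset) auto
    show "negligible {t \<in> {0..<2 * pi} - {0..2 * pi}. r * h (circle_point r t) \<noteq> 0}"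
      by (rule negligible_subset[of "{}"]) auto
  qed
  finally show ?thesis .
qed

section \<open>The flux of a solenoidal field with given trace\<close>

lemma (in finite_measure) integral_tendsto_0_if_l2_norm_tendsto_0:
  fixes \<phi> :: "nat \<Rightarrow> 'a \<Rightarrow> real"
  assumes f: "\<And>k. square_integrable M (f k)" "(\<lambda>k. l2_norm M (f k)) \<longlonglongrightarrow> 0"
    and \<phi>: "\<And>k. \<phi> k \<in> borel_measurable M" "\<And>k. AE x in M. \<bar>\<phi> k x\<bar> \<le> B * norm (f k x)"
  shows "(\<lambda>k. \<integral>x. \<phi> k x \<partial>M) \<longlonglongrightarrow> 0"
proof (rule Lim_null_comparison)
  have "norm (\<integral>x. \<phi> k x \<partial>M) \<le> \<bar>B\<bar> * (sqrt (measure M (space M)) * l2_norm M (f k))" for k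
  proof -
    have fi: "integrable M (\<lambda>x. \<bar>B\<bar> * norm (f k x))"
      using square_integrable_integrable[OF f(1)] by simp
    have le: "AE x in M. \<bar>\<phi> k x\<bar> \<le> \<bar>B\<bar> * norm (f k x)"
      using \<phi>(2)[of k] by eventually_elim (meson abs_ge_self mult_right_mono norm_ge_zero order_trans)
    have "integrable M (\<phi> k)"
      by (rule Bochner_Integration.integrable_bound[OF fi \<phi>(1)]) (use le in \<open>eventually_elim, auto\<close>)
    then have "norm (\<integral>x. \<phi> k x \<partial>M) \<le> (\<integral>x. \<bar>B\<bar> * norm (f k x) \<partial>M)"
      by (intro order_trans[OF integral_norm_bound] integral_mono_AE fi) (use le in auto)
    also have "\<dots> = \<bar>B\<bar> * (\<integral>x. norm (f k x) \<partial>M)" by simp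
    also have "\<dots> \<le> \<bar>B\<bar> * (sqrt (measure M (space M)) * l2_norm M (f k))"
      by (intro mult_left_mono integral_norm_le_l2_norm f) auto
    finally show ?thesis .
  qed
  then show "eventually (\<lambda>k. norm (\<integral>x. \<phi> k x \<partial>M) \<le> \<bar>B\<bar> * (sqrt (measure M (space M)) * l2_norm M (f k))) sequentially"
    by (intro always_eventually) auto
  show "(\<lambda>k. \<bar>B\<bar> * (sqrt (measure M (space M)) * l2_norm M (f k))) \<longlonglongrightarrow> 0"
    using f(2) by (intro tendsto_mult_right_zero)
qed

lemma W12_norm_tendsto_0D:
  assumes "(\<lambda>k. W12_norm \<Omega> (f k)) \<longlonglongrightarrow> 0"
  shows "(\<lambda>k. l2_norm (lebesgue_on \<Omega>) (f k)) \<longlonglongrightarrow> 0"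
    and "(\<lambda>k. l2_norm (lebesgue_on \<Omega>) (weak_grad \<Omega> (f k))) \<longlonglongrightarrow> 0"
proof -
  have nn: "0 \<le> l2_norm M f" for M and f :: "'z \<Rightarrow> 'y::euclidean_space"
    by (simp add: l2_norm_def)
  show "(\<lambda>k. l2_norm (lebesgue_on \<Omega>) (f k)) \<longlonglongrightarrow> 0"
    by (rule Lim_null_comparison[OF _ assms]) (simp add: W12_norm_def nn)
  show "(\<lambda>k. l2_norm (lebesgue_on \<Omega>) (weak_grad \<Omega> (f k))) \<longlonglongrightarrow> 0"
    by (rule Lim_null_comparison[OF _ assms]) (simp add: W12_norm_def nn)
qed

lemma trace_le_norm:
  fixes A :: "real^'n^'n"
  shows "\<bar>\<Sum>i\<in>UNIV. A $ i $ i\<bar> \<le> CARD('n) * norm A"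
proof -
  have "\<bar>\<Sum>i\<in>UNIV. A $ i $ i\<bar> \<le> (\<Sum>i\<in>UNIV. \<bar>A $ i $ i\<bar>)" by (rule sum_abs)
  also have "\<dots> \<le> (\<Sum>i\<in>(UNIV::'n set). norm A)"
    by (intro sum_mono) (metis Finite_Cartesian_Product.norm_nth_le order_trans real_norm_def)
  finally show ?thesis by simp
qed

text \<open>
  For a field \<open>w\<close> that is smooth up to the boundary this is the divergence theorem for \<open>H w\<close>, except
  for the term \<open>\<integral> H div w\<close>. The smooth approximations in the definition of the trace are not
  themselves solenoidal, but their divergences tend to zero in mean square. As \<open>H\<close> vanishes on the
  inner circle, only the flux through the outer one remains.
\<close>
lemma integral_radial_gradient:
  fixes V v :: "real^2 \<Rightarrow> real^2" and H :: "real^2 \<Rightarrow> real"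
  assumes R: "0 < R1" "R1 < R2"
    and sol: "solenoidal (annulus R1 R2) V" and trace: "has_trace R1 R2 V v"
    and H: "\<And>x. x \<in> closed_annulus R1 R2 \<Longrightarrow> (H has_derivative (\<lambda>h. X x \<bullet> h)) (at x)"
    and X: "continuous_on (closed_annulus R1 R2) X"
    and H_bdry: "\<And>x. norm x = R1 \<Longrightarrow> H x = 0" "\<And>x. norm x = R2 \<Longrightarrow> H x = c"
  shows "(\<integral>x. V x \<bullet> X x \<partial>lebesgue_on (annulus R1 R2))
    = c * (\<integral>x. v x \<bullet> outer_normal R1 R2 x \<partial>circle_measure R2)"
proof -
  let ?\<Omega> = "annulus R1 R2" and ?A = "closed_annulus R1 R2"
  note \<Omega> = open_annulus[of R1 R2] bounded_annulus[of R1 R2]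
  interpret finite_measure "lebesgue_on ?\<Omega>"
    using \<Omega> by (intro finite_measure_lebesgue_on bounded_set_imp_lmeasurable) (auto simp: lborelD)
  interpret C: finite_measure "circle_measure R2"
    using R by (intro finite_measure_circle) auto
  have VW: "V \<in> W12 ?\<Omega>" and v: "square_integrable (circle_measure R2) v"
    using trace by (auto simp: has_trace_def)
  obtain w where w: "\<And>k. smooth (w k)"
      "(\<lambda>k. W12_norm ?\<Omega> (\<lambda>x. w k x - V x)) \<longlonglongrightarrow> 0"
      "(\<lambda>k. l2_norm (circle_measure R2) (\<lambda>x. w k x - v x)) \<longlonglongrightarrow> 0"
    using trace unfolding has_trace_def by auto
  note lims = W12_norm_tendsto_0D[OF w(2)]
  define D where "D = (\<lambda>k x. frechet_derivative (w k) (at x))"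
  have ax: "axis j 1 \<in> (Basis :: (real^2) set)" for j by (simp add: axis_in_Basis_iff)
  have wd: "(w k has_derivative D k x) (at x)" for k x
    unfolding D_def by (rule smooth_C1(1)[OF w(1)])
  have wc: "continuous_on UNIV (\<lambda>x. D k x (axis j 1))" for k j
    unfolding D_def by (rule smooth_C1(2)[OF w(1) ax])
  have wc0: "continuous_on S (w k)" for k S
    using smooth_C1(3)[OF w(1)] by (rule continuous_on_subset) auto
  note VG = has_weak_grad_weak_grad[OF VW]
  have diff: "has_weak_grad ?\<Omega> (\<lambda>x. w k x - V x) (\<lambda>x. matrix (D k x) - weak_grad ?\<Omega> V x)" for k
    by (intro has_weak_grad_diff has_weak_grad_classical \<Omega> wd wc VG)
  have diffW: "(\<lambda>x. w k x - V x) \<in> W12 ?\<Omega>" for k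
    using diff by (auto simp: W12_def)
  have sq: "square_integrable (lebesgue_on ?\<Omega>) (\<lambda>x. w k x - V x)"
      "square_integrable (lebesgue_on ?\<Omega>) (weak_grad ?\<Omega> (\<lambda>x. w k x - V x))" for k
    using has_weak_grad_weak_grad[OF diffW] by (auto simp: has_weak_grad_def)
  have div_w: "AE x in lebesgue_on ?\<Omega>. (\<Sum>i\<in>UNIV. D k x (axis i 1) $ i)
      = (\<Sum>i\<in>UNIV. weak_grad ?\<Omega> (\<lambda>x. w k x - V x) x $ i $ i)" for k
    using weak_grad_AE_eq[OF \<Omega> diff[of k]] sol[unfolded solenoidal_def]
    by eventually_elim (simp add: matrix_def sum_subtractf)
  have compact_A: "compact ?A"
  proof -
    have "?A = cball 0 R2 - ball 0 R1" by (auto simp: closed_annulus_def)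
    then show ?thesis by (simp add: compact_diff)
  qed
  have H_cont: "continuous_on ?A H"
    by (meson H continuous_at_imp_continuous_on has_derivative_continuous)
  have "bounded (X ` ?A)" "bounded (H ` ?A)"
    using compact_A X H_cont by (auto intro: compact_imp_bounded compact_continuous_image)
  then obtain B where B: "\<And>x. x \<in> ?A \<Longrightarrow> norm (X x) \<le> B" "\<And>x. x \<in> ?A \<Longrightarrow> \<bar>H x\<bar> \<le> B"
    by (auto simp: bounded_iff) (metis max.coboundedI1 max.coboundedI2)
  have sub: "?\<Omega> \<subseteq> ?A" by (auto simp: annulus_def closed_annulus_def)
  have clos: "continuous_on (closure ?\<Omega>) f" if "continuous_on ?A f" for f :: "real^2 \<Rightarrow> real"
    using that closure_annulus_subset by (rule continuous_on_subset)
  have int1: "integrable (lebesgue_on ?\<Omega>) f" if "continuous_on ?A f" for f :: "real^2 \<Rightarrow> real"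
    using integrable_mult_continuous[OF \<Omega> integrable_const clos[OF that], of 1] by simp
  have Xm: "X \<in> borel_measurable (lebesgue_on ?\<Omega>)"
    using X \<Omega>(1) sub by (intro continuous_imp_measurable_on_sets_lebesgue) (auto simp: lborelD intro: continuous_on_subset)
  have Hm: "H \<in> borel_measurable (lebesgue_on ?\<Omega>)"
    using H_cont \<Omega>(1) sub by (intro continuous_imp_measurable_on_sets_lebesgue) (auto simp: lborelD intro: continuous_on_subset)
  have VX: "integrable (lebesgue_on ?\<Omega>) (\<lambda>x. V x \<bullet> X x)"
  proof -
    have "integrable (lebesgue_on ?\<Omega>) (\<lambda>x. \<Sum>i\<in>UNIV. V x $ i * X x $ i)"
      using VG X
      by (intro Bochner_Integration.integrable_sum integrable_mult_continuous \<Omega> square_integrable_component_integrable)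
         (auto simp: has_weak_grad_def intro!: continuous_intros clos)
    then show ?thesis by (simp add: inner_vec_def)
  qed
  have wX: "integrable (lebesgue_on ?\<Omega>) (\<lambda>x. w k x \<bullet> X x)" for k
    by (intro int1 continuous_intros wc0 X)
  have Hdiv: "integrable (lebesgue_on ?\<Omega>) (\<lambda>x. H x * (\<Sum>i\<in>UNIV. D k x (axis i 1) $ i))" for k
    by (intro int1 continuous_intros H_cont continuous_on_subset[OF wc]) auto
  have nu: "outer_normal R1 R2 x = x /\<^sub>R R2" if "norm x = R2" for x
    using that by (simp add: outer_normal_def)
  have sphere: "norm x = R2" if "x \<in> space (circle_measure R2)" for x
    using that R by (auto simp: circle_measure_def space_embed_measure)
  have id_m: "(\<lambda>x. x /\<^sub>R R2) \<in> borel_measurable (circle_measure R2)"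
    by (intro borel_measurable_circle_continuous continuous_intros)
  have vn: "integrable (circle_measure R2) (\<lambda>x. v x \<bullet> (x /\<^sub>R R2))"
  proof (rule Bochner_Integration.integrable_bound)
    show "integrable (circle_measure R2) v" using v by (rule C.square_integrable_integrable)
    show "AE x in circle_measure R2. norm (v x \<bullet> (x /\<^sub>R R2)) \<le> norm (v x)"
    proof (rule AE_I2)
      fix x assume "x \<in> space (circle_measure R2)"
      then have "norm (x /\<^sub>R R2) = 1" using sphere R by simp
      then show "norm (v x \<bullet> (x /\<^sub>R R2)) \<le> norm (v x)"
        using Cauchy_Schwarz_ineq2[of "v x" "x /\<^sub>R R2"] by simp
    qed
    show "(\<lambda>x. v x \<bullet> (x /\<^sub>R R2)) \<in> borel_measurable (circle_measure R2)"
      using v id_m by (intro borel_measurable_inner) (auto simp: square_integrable_def)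
  qed
  have w_circ: "square_integrable (circle_measure R2) (w k)" for k
    using R by (intro square_integrable_circle_continuous wc0) auto
  have wn: "integrable (circle_measure R2) (\<lambda>x. w k x \<bullet> (x /\<^sub>R R2))" for k
    using R by (intro C.square_integrable_integrable square_integrable_circle_continuous continuous_intros wc0) auto
  have green: "(\<integral>x. w k x \<bullet> X x \<partial>lebesgue_on ?\<Omega>)
      + (\<integral>x. H x * (\<Sum>i\<in>UNIV. D k x (axis i 1) $ i) \<partial>lebesgue_on ?\<Omega>)
      = c * (\<integral>x. w k x \<bullet> (x /\<^sub>R R2) \<partial>circle_measure R2)" for k
  proof -
    let ?F = "\<lambda>x. H x *\<^sub>R w k x" and ?F' = "\<lambda>x h. H x *\<^sub>R D k x h + (X x \<bullet> h) *\<^sub>R w k x"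
    have "(\<integral>x. (\<Sum>i\<in>UNIV. ?F' x (axis i 1) $ i) \<partial>lebesgue_on ?\<Omega>)
      = integral {0..2 * pi} (\<lambda>t. R2 * (?F (circle_point R2 t) \<bullet> circle_point 1 t))
      - integral {0..2 * pi} (\<lambda>t. R1 * (?F (circle_point R1 t) \<bullet> circle_point 1 t))"
    proof (rule divergence_theorem_annulus[OF R])
      show "(?F has_derivative ?F' x) (at x)" if "x \<in> ?A" for x
        by (rule has_derivative_scaleR[OF H[OF that] wd])
      show "continuous_on ?A (\<lambda>x. ?F' x (axis j 1))" for j
        by (intro continuous_intros H_cont X wc0 continuous_on_subset[OF wc]) auto
    qed
    also have "(\<lambda>t. R1 * (?F (circle_point R1 t) \<bullet> circle_point 1 t)) = (\<lambda>t. 0)"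
      using R by (simp add: H_bdry)
    also have "(\<lambda>t. R2 * (?F (circle_point R2 t) \<bullet> circle_point 1 t))
        = (\<lambda>t. c * (R2 * (w k (circle_point R2 t) \<bullet> (circle_point R2 t /\<^sub>R R2))))"
      using R by (simp add: H_bdry circle_point_eq_scaleR[of R2] fun_eq_iff)
    also have "integral {0..2 * pi} \<dots> = c * (\<integral>x. w k x \<bullet> (x /\<^sub>R R2) \<partial>circle_measure R2)"
      using R by (subst integral_circle_continuous) (auto intro!: continuous_intros wc0)
    finally have *: "(\<integral>x. (\<Sum>i\<in>UNIV. ?F' x (axis i 1) $ i) \<partial>lebesgue_on ?\<Omega>)
        = c * (\<integral>x. w k x \<bullet> (x /\<^sub>R R2) \<partial>circle_measure R2)" by simp
    have "(\<Sum>i\<in>UNIV. ?F' x (axis i 1) $ i) = w k x \<bullet> X x + H x * (\<Sum>i\<in>UNIV. D k x (axis i 1) $ i)" for x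
      by (simp add: sum.distrib sum_distrib_left inner_axis inner_vec_def[of "w k x"] mult.commute)
    with * show ?thesis
      by (simp add: Bochner_Integration.integral_add[OF wX Hdiv])
  qed
  have lim1: "(\<lambda>k. \<integral>x. w k x \<bullet> X x - V x \<bullet> X x \<partial>lebesgue_on ?\<Omega>) \<longlonglongrightarrow> 0"
  proof (rule integral_tendsto_0_if_l2_norm_tendsto_0[OF sq(1) lims(1)])
    show "(\<lambda>x. w k x \<bullet> X x - V x \<bullet> X x) \<in> borel_measurable (lebesgue_on ?\<Omega>)" for k
      using wX[of k] VX by simp
    show "AE x in lebesgue_on ?\<Omega>. \<bar>w k x \<bullet> X x - V x \<bullet> X x\<bar> \<le> B * norm (w k x - V x)" for k
    proof (rule AE_I2)
      fix x assume "x \<in> space (lebesgue_on ?\<Omega>)"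
      then have "norm (X x) \<le> B" using B(1) sub by auto
      have "\<bar>w k x \<bullet> X x - V x \<bullet> X x\<bar> \<le> norm (w k x - V x) * norm (X x)"
        using Cauchy_Schwarz_ineq2[of "w k x - V x" "X x"] by (simp add: inner_diff_left)
      also have "\<dots> \<le> norm (w k x - V x) * B"
        using \<open>norm (X x) \<le> B\<close> by (intro mult_left_mono) auto
      finally show "\<bar>w k x \<bullet> X x - V x \<bullet> X x\<bar> \<le> B * norm (w k x - V x)" by (simp add: mult.commute)
    qed
  qed
  have lim2: "(\<lambda>k. \<integral>x. H x * (\<Sum>i\<in>UNIV. D k x (axis i 1) $ i) \<partial>lebesgue_on ?\<Omega>) \<longlonglongrightarrow> 0"
  proof (rule integral_tendsto_0_if_l2_norm_tendsto_0[OF sq(2) lims(2)])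
    show "(\<lambda>x. H x * (\<Sum>i\<in>UNIV. D k x (axis i 1) $ i)) \<in> borel_measurable (lebesgue_on ?\<Omega>)" for k
      using Hdiv[of k] by simp
    have "AE x in lebesgue_on ?\<Omega>. x \<in> ?\<Omega>" by (rule AE_I2) simp
    then show "AE x in lebesgue_on ?\<Omega>. \<bar>H x * (\<Sum>i\<in>UNIV. D k x (axis i 1) $ i)\<bar>
        \<le> (B * 2) * norm (weak_grad ?\<Omega> (\<lambda>x. w k x - V x) x)" for k
      using div_w[of k]
    proof eventually_elim
      case (elim x)
      have "\<bar>H x * (\<Sum>i\<in>UNIV. D k x (axis i 1) $ i)\<bar>
          \<le> B * (2 * norm (weak_grad ?\<Omega> (\<lambda>x. w k x - V x) x))"
        unfolding elim(2) abs_mult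
        using B(2)[of x] sub elim(1) trace_le_norm[of "weak_grad ?\<Omega> (\<lambda>x. w k x - V x) x"]
        by (intro mult_mono) auto
      then show ?case by simp
    qed
  qed
  have lim3: "(\<lambda>k. \<integral>x. w k x \<bullet> (x /\<^sub>R R2) - v x \<bullet> (x /\<^sub>R R2) \<partial>circle_measure R2) \<longlonglongrightarrow> 0"
  proof (rule C.integral_tendsto_0_if_l2_norm_tendsto_0[OF square_integrable_diff[OF w_circ v] w(3)])
    show "(\<lambda>x. w k x \<bullet> (x /\<^sub>R R2) - v x \<bullet> (x /\<^sub>R R2)) \<in> borel_measurable (circle_measure R2)" for k
      using borel_measurable_integrable[OF Bochner_Integration.integrable_diff[OF wn vn]] .
    show "AE x in circle_measure R2. \<bar>w k x \<bullet> (x /\<^sub>R R2) - v x \<bullet> (x /\<^sub>R R2)\<bar> \<le> 1 * norm (w k x - v x)" for k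
    proof (rule AE_I2)
      fix x assume "x \<in> space (circle_measure R2)"
      then have "norm (x /\<^sub>R R2) = 1" using sphere R by simp
      then show "\<bar>w k x \<bullet> (x /\<^sub>R R2) - v x \<bullet> (x /\<^sub>R R2)\<bar> \<le> 1 * norm (w k x - v x)"
        using Cauchy_Schwarz_ineq2[of "w k x - v x" "x /\<^sub>R R2"] by (simp only: inner_diff_left)
    qed
  qed
  let ?I = "\<integral>x. V x \<bullet> X x \<partial>lebesgue_on ?\<Omega>" and ?J = "\<integral>x. v x \<bullet> (x /\<^sub>R R2) \<partial>circle_measure R2"
  have "(\<lambda>k. c * (\<integral>x. w k x \<bullet> (x /\<^sub>R R2) - v x \<bullet> (x /\<^sub>R R2) \<partial>circle_measure R2)
      - (\<integral>x. w k x \<bullet> X x - V x \<bullet> X x \<partial>lebesgue_on ?\<Omega>)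
      - (\<integral>x. H x * (\<Sum>i\<in>UNIV. D k x (axis i 1) $ i) \<partial>lebesgue_on ?\<Omega>)) \<longlonglongrightarrow> c * 0 - 0 - 0"
    by (intro tendsto_intros lim1 lim2 lim3)
  also have "(\<lambda>k. c * (\<integral>x. w k x \<bullet> (x /\<^sub>R R2) - v x \<bullet> (x /\<^sub>R R2) \<partial>circle_measure R2)
      - (\<integral>x. w k x \<bullet> X x - V x \<bullet> X x \<partial>lebesgue_on ?\<Omega>)
      - (\<integral>x. H x * (\<Sum>i\<in>UNIV. D k x (axis i 1) $ i) \<partial>lebesgue_on ?\<Omega>)) = (\<lambda>k. ?I - c * ?J)"
  proof
    fix k
    show "c * (\<integral>x. w k x \<bullet> (x /\<^sub>R R2) - v x \<bullet> (x /\<^sub>R R2) \<partial>circle_measure R2)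
      - (\<integral>x. w k x \<bullet> X x - V x \<bullet> X x \<partial>lebesgue_on ?\<Omega>)
      - (\<integral>x. H x * (\<Sum>i\<in>UNIV. D k x (axis i 1) $ i) \<partial>lebesgue_on ?\<Omega>) = ?I - c * ?J"
      using green[of k]
      unfolding Bochner_Integration.integral_diff[OF wX VX] Bochner_Integration.integral_diff[OF wn vn]
      by (simp only: right_diff_distrib)
  qed
  finally have "?I = c * ?J" by (simp add: LIMSEQ_const_iff)
  also have "?J = (\<integral>x. v x \<bullet> outer_normal R1 R2 x \<partial>circle_measure R2)"
    by (intro Bochner_Integration.integral_cong) (auto simp: sphere nu)
  finally show ?thesis .
qed

section \<open>The radial profile\<close>

lemma elementary_real_derivative:
  assumes "f \<in> elementary"
  shows "\<exists>f'\<in>elementary. \<forall>t. (f has_real_derivative f' t) (at t)"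
proof -
  obtain D where D: "\<forall>x. (f has_derivative D x) (at x)" "\<forall>b. (\<lambda>x. D x b) \<in> elementary"
    using elementary_has_derivative[OF assms] by blast
  have "(f has_real_derivative D t 1) (at t)" for t
  proof -
    have "D t h = D t 1 * h" for h
      using linear_cmul[OF has_derivative_linear[OF D(1)[rule_format, of t]], of h 1]
      by (simp add: mult.commute)
    then have "D t = (*) (D t 1)" by (rule ext)
    then show ?thesis using D(1) unfolding has_field_derivative_def by metis
  qed
  with D(2) show ?thesis by (intro bexI[of _ "\<lambda>x. D x 1"]) auto
qed

lemma elementary_continuous: "f \<in> elementary \<Longrightarrow> continuous_on S f"
  using elementary_has_derivative
  by (metis continuous_at_imp_continuous_on has_derivative_continuous)

lemma exists_bump:
  fixes a b :: real
  assumes "a < b"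
  obtains e e' :: "real \<Rightarrow> real" where "e \<in> elementary" "e' \<in> elementary" "\<And>s. (e has_real_derivative e' s) (at s)"
    "\<And>s. s \<notin> {a<..<b} \<Longrightarrow> e s = 0 \<and> e' s = 0" "\<And>s. s \<in> {a<..<b} \<Longrightarrow> e s > 0"
proof -
  define e where "e = (\<lambda>s. flat 0 (s - a) * flat 0 (b - s))"
  define e' where "e' = (\<lambda>s. flat 2 (s - a) * flat 0 (b - s) - flat 0 (s - a) * flat 2 (b - s))"
  have "(e has_real_derivative e' s) (at s)" for s
  proof -
    have "((\<lambda>s. s - a) has_real_derivative 1) (at s)" "((\<lambda>s. b - s) has_real_derivative -1) (at s)"
      by (auto intro!: derivative_eq_intros)
    from this[THEN DERIV_chain2[OF has_real_derivative_flat], of 0]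
    have "((\<lambda>s. flat 0 (s - a)) has_real_derivative flat 2 (s - a)) (at s)"
        "((\<lambda>s. flat 0 (b - s)) has_real_derivative - flat 2 (b - s)) (at s)"
      by (simp_all add: numeral_2_eq_2)
    then show ?thesis
      unfolding e_def e'_def by (auto intro!: derivative_eq_intros)
  qed
  moreover have "e \<in> elementary" "e' \<in> elementary"
    unfolding e_def e'_def by (auto intro!: elementary_intros)
  ultimately show ?thesis
    by (intro that[of e e']) (auto simp: e_def e'_def flat_def)
qed

text \<open>
  The coefficient \<open>g\<close> of \<open>x \<otimes> x\<close>, at \<open>s = |x|\<^sup>2\<close>, in the sum of the squares \<open>u \<otimes> u\<close> over the two fields with
  stream functions \<open>b(|x|\<^sup>2) Re z\<^sup>N\<close> and \<open>b(|x|\<^sup>2) Im z\<^sup>N\<close>. Here \<open>N = n + 1\<close>, and \<open>b'\<close> is the derivative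
  of \<open>b\<close>.
\<close>
definition radial_weight :: "nat \<Rightarrow> (real \<Rightarrow> real) \<Rightarrow> (real \<Rightarrow> real) \<Rightarrow> real \<Rightarrow> real" where
  "radial_weight n b b' s = - (4 * s ^ n * b' s * (s * b' s + real (Suc n) * b s))"

text \<open>
  The factor \<open>s\<^bsup>-N/2\<^esup>\<close> in \<open>b(s) = s\<^bsup>-N/2\<^esup> e(s)\<close> compensates the growth of \<open>z\<^sup>N\<close>. Without it the mass
  of \<open>g\<close> would move towards the outer edge of the support of the bump as \<open>N\<close> grows, where \<open>e'\<close>
  dominates \<open>e\<close>. The proof takes \<open>N = 4 k\<close>, so that \<open>s\<^bsup>-N/2\<^esup>\<close> is a power of \<open>s\<^bsup>-2\<^esup>\<close>.
\<close>
lemma exists_radial_profile: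
  fixes \<alpha> \<beta> :: real
  assumes "0 < \<alpha>" "\<alpha> < \<beta>"
  obtains b b' :: "real \<Rightarrow> real" and l r n where
    "b \<in> elementary" "b' \<in> elementary" "\<And>s. (b has_real_derivative b' s) (at s)"
    "\<alpha> < l" "r < \<beta>" "\<And>s. s \<notin> {l..r} \<Longrightarrow> b s = 0 \<and> b' s = 0"
    "0 < integral {\<alpha>..\<beta>} (radial_weight n b b')"
proof -
  define l where "l = (2 * \<alpha> + \<beta>) / 3"
  define r where "r = (\<alpha> + 2 * \<beta>) / 3"
  have lr: "\<alpha> < l" "l < r" "r < \<beta>" "0 < l" using assms by (auto simp: l_def r_def)
  obtain e e' :: "real \<Rightarrow> real" where e: "e \<in> elementary" "e' \<in> elementary" "\<And>s. (e has_real_derivative e' s) (at s)"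
    "\<And>s. s \<notin> {l<..<r} \<Longrightarrow> e s = 0 \<and> e' s = 0" "\<And>s. s \<in> {l<..<r} \<Longrightarrow> e s > 0"
    using exists_bump[OF lr(2)] by blast
  define I1 where "I1 = integral {\<alpha>..\<beta>} (\<lambda>s. (e s)\<^sup>2 / s\<^sup>2)"
  define I2 where "I2 = integral {\<alpha>..\<beta>} (\<lambda>s. (e' s)\<^sup>2)"
  have c1: "continuous_on {\<alpha>..\<beta>} (\<lambda>s. (e s)\<^sup>2 / s\<^sup>2)" and c2: "continuous_on {\<alpha>..\<beta>} (\<lambda>s. (e' s)\<^sup>2)"
    using assms elementary_continuous[OF e(1)] elementary_continuous[OF e(2)]
    by (auto intro!: continuous_intros)
  have "0 \<le> I1" unfolding I1_def by (intro integral_nonneg integrable_continuous_real c1) simp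
  moreover have "I1 \<noteq> 0"
  proof
    assume "I1 = 0"
    then have "\<forall>s\<in>{\<alpha>..\<beta>}. (e s)\<^sup>2 / s\<^sup>2 = 0"
      unfolding I1_def using assms c1 by (subst (asm) integral_eq_0_iff) auto
    moreover have "(l + r) / 2 \<in> {\<alpha>..\<beta>}" "e ((l + r) / 2) > 0" using lr by (auto intro!: e(5))
    moreover have "(l + r) / 2 \<noteq> 0" using lr by auto
    ultimately show False by (metis divide_eq_0_iff less_irrefl power_not_zero)
  qed
  ultimately have "0 < I1" by simp
  obtain j :: nat where j: "I2 / I1 < real j" using reals_Archimedean2 by blast
  define k where "k = Suc j"
  have k: "0 < k" "I2 / I1 < real k" using j by (auto simp: k_def)
  have "I2 < real k * I1" using k \<open>0 < I1\<close> by (simp add: pos_divide_less_eq)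
  also have "\<dots> \<le> 4 * (real k)\<^sup>2 * I1"
    using k(1) \<open>0 < I1\<close> by (intro mult_right_mono) (auto simp: power2_eq_square k_def)
  finally have I21: "I2 < 4 * (real k)\<^sup>2 * I1" .
  \<comment> \<open>equal to \<open>s\<^bsup>-2\<^esup>\<close> on the support of \<open>e\<close>, but with a denominator that is positive on the whole line\<close>
  define \<tau> where "\<tau> = (\<lambda>s. inverse (s\<^sup>2 + flat 0 (l - s)))"
  have pos: "s\<^sup>2 + flat 0 (l - s) \<noteq> 0" for s
  proof (cases "s = 0")
    case True
    then show ?thesis using lr by (simp add: flat_def)
  next
    case False
    then have "0 < s\<^sup>2" by simp
    then show ?thesis using flat_0_bounds(1)[of "l - s"] by linarith
  qed
  have \<tau>: "\<tau> \<in> elementary"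
    unfolding \<tau>_def by (intro elementary_intros pos)
  define b where "b = (\<lambda>s. e s * \<tau> s ^ k)"
  have b: "b \<in> elementary"
    unfolding b_def by (intro elementary_intros e \<tau>)
  obtain t where t: "t \<in> elementary" "\<And>s. ((\<lambda>s. \<tau> s ^ k) has_real_derivative t s) (at s)"
    using elementary_real_derivative[OF elementary_power[OF \<tau>]] by blast
  define b' where "b' = (\<lambda>s. e' s * \<tau> s ^ k + t s * e s)"
  have b': "b' \<in> elementary"
    unfolding b'_def by (intro elementary_intros e \<tau> t)
  have der: "(b has_real_derivative b' s) (at s)" for s
    unfolding b_def b'_def by (rule DERIV_mult[OF e(3) t(2)])
  have weight: "radial_weight (4 * k - 1) b b' s = 4 * (4 * (real k)\<^sup>2 * ((e s)\<^sup>2 / s\<^sup>2) - (e' s)\<^sup>2)"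
    if "s \<in> {\<alpha>..\<beta>}" for s
  proof (cases "s \<in> {l<..<r}")
    case False
    then show ?thesis using e(4)[OF False] by (simp add: radial_weight_def b_def b'_def)
  next
    case True
    then have s: "l < s" "0 < s" using lr by auto
    have \<tau>_eq: "\<tau> u ^ k = inverse (u ^ (2 * k))" if "l < u" for u
      using that by (simp add: \<tau>_def flat_def power_inverse power_mult)
    have sk: "s * s ^ (2 * k - Suc 0) = s ^ (2 * k)"
      using k(1) by (cases k) auto
    have "((\<lambda>u. inverse (u ^ (2 * k))) has_real_derivative
        - (inverse (s ^ (2 * k)) * (real (2 * k) * s ^ (2 * k - Suc 0)) * inverse (s ^ (2 * k)))) (at s)"
      using s by (auto intro!: derivative_eq_intros)
    then have "((\<lambda>u. \<tau> u ^ k) has_real_derivative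
        - (inverse (s ^ (2 * k)) * (real (2 * k) * s ^ (2 * k - Suc 0)) * inverse (s ^ (2 * k)))) (at s)"
      by (rule has_field_derivative_transform_within_open[of _ _ _ "{l<..}"]) (use s \<tau>_eq in auto)
    then have "t s = - (inverse (s ^ (2 * k)) * (real (2 * k) * s ^ (2 * k - Suc 0)) * inverse (s ^ (2 * k)))"
      using t(2) DERIV_unique by blast
    then have "s * t s = - (inverse (s ^ (2 * k)) * (real (2 * k) * (s * s ^ (2 * k - Suc 0))) * inverse (s ^ (2 * k)))"
      by simp
    then have ts: "s * t s = - (2 * real k) * inverse (s ^ (2 * k))"
      unfolding sk using s by simp
    define Q where "Q = inverse (s ^ (2 * k))"
    have bs: "b s = e s * Q"
      using \<tau>_eq[OF s(1)] by (simp add: b_def Q_def)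
    have "s * b' s = s * e' s * Q + e s * (s * t s)"
      using \<tau>_eq[OF s(1)] by (simp add: b'_def Q_def algebra_simps)
    then have b's: "s * b' s = (s * e' s - 2 * real k * e s) * Q"
      unfolding ts Q_def by (simp add: algebra_simps)
    have "s ^ (4 * k - 1) * s = (s ^ (2 * k))\<^sup>2"
      using power_minus_mult[of "4 * k" s] k(1) by (simp flip: power_mult)
    then have S: "s ^ (4 * k - 1) = inverse s * (s ^ (2 * k))\<^sup>2"
      using s by (simp add: field_simps)
    have "radial_weight (4 * k - 1) b b' s
        = - (4 * (inverse s * (s ^ (2 * k))\<^sup>2) * b' s * (s * b' s + 4 * real k * b s))"
      using k(1) unfolding radial_weight_def S by (simp add: of_nat_diff)
    also have "\<dots> = - (4 * (s ^ (2 * k))\<^sup>2 * (s * b' s) * (s * b' s + 4 * real k * b s)) / s\<^sup>2"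
      using s by (simp add: field_simps power2_eq_square)
    also have "\<dots> = - (4 * (s ^ (2 * k) * Q)\<^sup>2 * ((s * e' s - 2 * real k * e s) * (s * e' s + 2 * real k * e s))) / s\<^sup>2"
      unfolding bs b's by (simp add: algebra_simps power2_eq_square)
    also have "s ^ (2 * k) * Q = 1" using s by (simp add: Q_def)
    finally show ?thesis
      using s by (simp add: field_simps power2_eq_square)
  qed
  have "integral {\<alpha>..\<beta>} (radial_weight (4 * k - 1) b b')
      = integral {\<alpha>..\<beta>} (\<lambda>s. 4 * (4 * (real k)\<^sup>2 * ((e s)\<^sup>2 / s\<^sup>2) - (e' s)\<^sup>2))"
    by (rule Henstock_Kurzweil_Integration.integral_cong[OF weight])
  also have "\<dots> = 4 * (4 * (real k)\<^sup>2 * I1 - I2)"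
    unfolding I1_def I2_def
    by (intro integral_unique has_integral_mult_right has_integral_diff integrable_integral
        integrable_continuous_real c1 c2)
  finally have weight_integral: "integral {\<alpha>..\<beta>} (radial_weight (4 * k - 1) b b')
      = 4 * (4 * (real k)\<^sup>2 * I1 - I2)" .
  have "0 < integral {\<alpha>..\<beta>} (radial_weight (4 * k - 1) b b')"
    unfolding weight_integral by (rule mult_pos_pos) (simp, simp only: diff_gt_0_iff_gt I21)
  moreover have "b s = 0 \<and> b' s = 0" if "s \<notin> {l..r}" for s
    using e(4)[of s] that by (auto simp: b_def b'_def)
  ultimately show thesis
    using that[OF b b' der lr(1,3)] by blast
qed

section \<open>The pair of test fields\<close>

definition to_complex :: "real^2 \<Rightarrow> complex" where
  "to_complex x = Complex (x $ 1) (x $ 2)"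

lemma elementary_complex_power:
  "(\<lambda>x. Re (w * to_complex x ^ n)) \<in> elementary \<and> (\<lambda>x. Im (w * to_complex x ^ n)) \<in> elementary"
proof (induction n arbitrary: w)
  case 0
  show ?case by (auto intro: elementary_intros)
next
  case (Suc n)
  have "Re (w * to_complex x ^ Suc n) = x $ 1 * Re (w * to_complex x ^ n) - x $ 2 * Im (w * to_complex x ^ n)"
      "Im (w * to_complex x ^ Suc n) = x $ 1 * Im (w * to_complex x ^ n) + x $ 2 * Re (w * to_complex x ^ n)" for x
  proof -
    have "w * to_complex x ^ Suc n = to_complex x * (w * to_complex x ^ n)" by simp
    then show "Re (w * to_complex x ^ Suc n) = x $ 1 * Re (w * to_complex x ^ n) - x $ 2 * Im (w * to_complex x ^ n)"
      "Im (w * to_complex x ^ Suc n) = x $ 1 * Im (w * to_complex x ^ n) + x $ 2 * Re (w * to_complex x ^ n)"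
      by (simp_all only: times_complex.sel) (simp_all add: to_complex_def)
  qed
  note eq = this and IH = Suc.IH[THEN conjunct1] Suc.IH[THEN conjunct2]
  show ?case
    unfolding eq
    by (intro conjI elementary_diff elementary.add elementary.mult elementary_nth IH)
qed

lemma has_derivative_complex_power:
  "((\<lambda>x. Re (w * to_complex x ^ n)) has_derivative
      (\<lambda>h. Re (w * (of_nat n * to_complex x ^ (n - 1) * to_complex h)))) (at x)"
  "((\<lambda>x. Im (w * to_complex x ^ n)) has_derivative
      (\<lambda>h. Im (w * (of_nat n * to_complex x ^ (n - 1) * to_complex h)))) (at x)"
proof -
  have "bounded_linear to_complex"
    unfolding linear_conv_bounded_linear[symmetric]
    by (rule linearI) (auto simp: to_complex_def complex_eq_iff)
  then have z: "(to_complex has_derivative to_complex) (at x)" by (rule bounded_linear_imp_has_derivative)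
  have "((\<lambda>x. w * to_complex x ^ n) has_derivative
      (\<lambda>h. w * (of_nat n * to_complex h * to_complex x ^ (n - 1)))) (at x)"
    by (rule has_derivative_mult_right[OF has_derivative_power[OF z]])
  then have d: "((\<lambda>x. w * to_complex x ^ n) has_derivative
      (\<lambda>h. w * (of_nat n * to_complex x ^ (n - 1) * to_complex h))) (at x)"
    by (simp only: mult.assoc mult.commute mult.left_commute)
  show "((\<lambda>x. Re (w * to_complex x ^ n)) has_derivative
      (\<lambda>h. Re (w * (of_nat n * to_complex x ^ (n - 1) * to_complex h)))) (at x)"
    using has_derivative_Re[OF d] .
  show "((\<lambda>x. Im (w * to_complex x ^ n)) has_derivative
      (\<lambda>h. Im (w * (of_nat n * to_complex x ^ (n - 1) * to_complex h)))) (at x)"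
    using has_derivative_Im[OF d] .
qed

text \<open>
  The field \<open>(\<partial>\<^sub>2 \<psi>, - \<partial>\<^sub>1 \<psi>)\<close> for the stream function \<open>\<psi>(x) = b(|x|\<^sup>2) Re (w z\<^sup>N)\<close> with \<open>N = n + 1\<close>, where
  \<open>b'\<close> is the derivative of \<open>b\<close>. The values \<open>w = 1\<close> and \<open>w = - \<i>\<close> give the real and the imaginary part
  of \<open>z\<^sup>N\<close>. The partial derivatives are written out with \<open>\<partial>\<^sub>1 Re f = Re f'\<close> and \<open>\<partial>\<^sub>2 Re f = - Im f'\<close> for
  holomorphic \<open>f\<close>.
\<close>
definition stream_field :: "nat \<Rightarrow> (real \<Rightarrow> real) \<Rightarrow> (real \<Rightarrow> real) \<Rightarrow> complex \<Rightarrow> real^2 \<Rightarrow> real^2" where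
  "stream_field n b b' w x = (let s = (norm x)\<^sup>2; p = Re (w * to_complex x ^ Suc n);
     q = w * to_complex x ^ n in
     vector [2 * b' s * x $ 2 * p - real (Suc n) * b s * Im q,
             - (2 * b' s * x $ 1 * p + real (Suc n) * b s * Re q)])"

lemma stream_field_nth:
  "stream_field n b b' w x $ 1 = 2 * b' ((norm x)\<^sup>2) * x $ 2 * Re (w * to_complex x ^ Suc n)
     - real (Suc n) * b ((norm x)\<^sup>2) * Im (w * to_complex x ^ n)"
  "stream_field n b b' w x $ 2 = - (2 * b' ((norm x)\<^sup>2) * x $ 1 * Re (w * to_complex x ^ Suc n)
     + real (Suc n) * b ((norm x)\<^sup>2) * Re (w * to_complex x ^ n))"
  by (simp_all only: stream_field_def Let_def vector_2)

lemma elementary_stream_field: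
  assumes "b \<in> elementary" "b' \<in> elementary"
  shows "(\<lambda>x. stream_field n b b' w x $ i) \<in> elementary"
proof -
  have bs: "(\<lambda>x::real^2. b ((norm x)\<^sup>2)) \<in> elementary" "(\<lambda>x::real^2. b' ((norm x)\<^sup>2)) \<in> elementary"
    by (rule elementary_compose[OF assms(1) elementary_norm_power2]
        elementary_compose[OF assms(2) elementary_norm_power2])+
  note zs = elementary_complex_power[THEN conjunct1] elementary_complex_power[THEN conjunct2]
  have "(\<lambda>x. stream_field n b b' w x $ 1) \<in> elementary"
    unfolding stream_field_nth
    by (intro elementary_diff elementary.mult elementary.const elementary_nth bs zs)
  moreover have "(\<lambda>x. stream_field n b b' w x $ 2) \<in> elementary"
    unfolding stream_field_nth
    by (intro elementary_minus elementary.add elementary.mult elementary.const elementary_nth bs zs)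
  ultimately show ?thesis
    using exhaust_2[of i] by auto
qed

lemma stream_field_divergence:
  assumes b: "b \<in> elementary" "b' \<in> elementary" "\<And>s. (b has_real_derivative b' s) (at s)"
    and D: "(stream_field n b b' w has_derivative D) (at x)"
  shows "(\<Sum>i\<in>UNIV. D (axis i 1) $ i) = 0"
proof -
  obtain b'' where b'': "\<And>s. (b' has_real_derivative b'' s) (at s)"
    using elementary_real_derivative[OF b(2)] by blast
  define s where "s = (norm x)\<^sup>2"
  have sq: "((\<lambda>x::real^2. (norm x)\<^sup>2) has_derivative (\<lambda>h. 2 * (x \<bullet> h))) (at x)"
    unfolding power2_norm_eq_inner by (auto intro!: derivative_eq_intros simp: inner_commute)
  have db: "((\<lambda>x::real^2. b ((norm x)\<^sup>2)) has_derivative (\<lambda>h. 2 * (x \<bullet> h) * b' s)) (at x)"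
    unfolding s_def by (rule DERIV_compose_FDERIV[OF b(3) sq])
  have db': "((\<lambda>x::real^2. b' ((norm x)\<^sup>2)) has_derivative (\<lambda>h. 2 * (x \<bullet> h) * b'' s)) (at x)"
    unfolding s_def by (rule DERIV_compose_FDERIV[OF b'' sq])
  have nth: "((\<lambda>x::real^2. x $ i) has_derivative (\<lambda>h. h $ i)) (at x)" for i
    using bounded_linear_imp_has_derivative[OF bounded_linear_vec_nth] .
  define N where "N = real (Suc n)"
  define P where "P = Re (w * to_complex x ^ Suc n)"
  define A where "A = w * to_complex x ^ n"
  define Z where "Z = w * (of_nat n * to_complex x ^ (n - 1))"
  have cN: "of_nat (Suc n) = complex_of_real N" unfolding N_def by simp
  have dP: "((\<lambda>x. Re (w * to_complex x ^ Suc n)) has_derivative (\<lambda>h. N * Re (A * to_complex h))) (at x)"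
    by (rule has_derivative_eq_rhs[OF has_derivative_complex_power(1)])
       (simp add: A_def cN fun_eq_iff algebra_simps del: of_nat_Suc power_Suc)
  have dA: "((\<lambda>x. Re (w * to_complex x ^ n)) has_derivative (\<lambda>h. Re (Z * to_complex h))) (at x)"
      "((\<lambda>x. Im (w * to_complex x ^ n)) has_derivative (\<lambda>h. Im (Z * to_complex h))) (at x)"
    using has_derivative_complex_power[of w n x] by (simp_all only: Z_def mult.assoc)
  have d1: "((\<lambda>x. stream_field n b b' w x $ 1) has_derivative
      (\<lambda>h. (2 * b' s * x $ 2 * (N * Re (A * to_complex h)) + (2 * b' s * h $ 2 + 2 * (2 * (x \<bullet> h) * b'' s) * x $ 2) * P)
        - (N * b s * Im (Z * to_complex h) + N * (2 * (x \<bullet> h) * b' s) * Im A))) (at x)"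
    unfolding stream_field_nth N_def[symmetric] P_def A_def s_def
    by (intro has_derivative_diff has_derivative_mult has_derivative_mult_right nth
        db[unfolded s_def] db'[unfolded s_def] dP[unfolded A_def] dA)
  have d2: "((\<lambda>x. stream_field n b b' w x $ 2) has_derivative
      (\<lambda>h. - ((2 * b' s * x $ 1 * (N * Re (A * to_complex h)) + (2 * b' s * h $ 1 + 2 * (2 * (x \<bullet> h) * b'' s) * x $ 1) * P)
        + (N * b s * Re (Z * to_complex h) + N * (2 * (x \<bullet> h) * b' s) * Re A)))) (at x)"
    unfolding stream_field_nth N_def[symmetric] P_def A_def s_def
    by (intro has_derivative_add has_derivative_minus has_derivative_mult has_derivative_mult_right nth
        db[unfolded s_def] db'[unfolded s_def] dP[unfolded A_def] dA)
  have Di: "((\<lambda>x. stream_field n b b' w x $ i) has_derivative (\<lambda>h. D h $ i)) (at x)" for i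
    using bounded_linear.has_derivative[OF bounded_linear_vec_nth D] .
  have D1: "D h $ 1 = (2 * b' s * x $ 2 * (N * Re (A * to_complex h)) + (2 * b' s * h $ 2 + 2 * (2 * (x \<bullet> h) * b'' s) * x $ 2) * P)
        - (N * b s * Im (Z * to_complex h) + N * (2 * (x \<bullet> h) * b' s) * Im A)" for h
    using fun_cong[OF has_derivative_unique[OF Di d1], of h] .
  have D2: "D h $ 2 = - ((2 * b' s * x $ 1 * (N * Re (A * to_complex h)) + (2 * b' s * h $ 1 + 2 * (2 * (x \<bullet> h) * b'' s) * x $ 1) * P)
        + (N * b s * Re (Z * to_complex h) + N * (2 * (x \<bullet> h) * b' s) * Re A))" for h
    using fun_cong[OF has_derivative_unique[OF Di d2], of h] .
  have ax: "to_complex (axis 1 1) = 1" "to_complex (axis 2 1) = \<i>"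
    by (simp_all add: to_complex_def axis_def complex_eq_iff)
  show ?thesis
    unfolding sum_2 D1 D2 ax inner_axis by (simp add: axis_def algebra_simps)
qed

text \<open>
  Write \<open>p = Re z\<^sup>N\<close> and \<open>q = Im z\<^sup>N\<close>. By the Cauchy--Riemann equations \<open>\<nabla>p \<otimes> \<nabla>p + \<nabla>q \<otimes> \<nabla>q\<close> is a multiple
  of the identity, and \<open>p \<nabla>p + q \<nabla>q\<close> is half the gradient of the radial function \<open>|z|\<^bsup>2N\<^esup>\<close>. Hence the
  squares of the gradients of the two stream functions add up to a multiple of \<open>x \<otimes> x\<close> plus a
  multiple of the identity; rotation by a right angle, which turns gradients into stream fields,
  preserves this form because it maps \<open>x \<otimes> x\<close> to \<open>|x|\<^sup>2 I - x \<otimes> x\<close>.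
\<close>
lemma stream_field_products:
  "stream_field n b b' 1 x $ i * stream_field n b b' 1 x $ j
   + stream_field n b b' (- \<i>) x $ i * stream_field n b b' (- \<i>) x $ j
   = radial_weight n b b' ((norm x)\<^sup>2) * x $ i * x $ j
     + (if i = j then ((real (Suc n) * b ((norm x)\<^sup>2))\<^sup>2 * ((norm x)\<^sup>2) ^ n
          - (norm x)\<^sup>2 * radial_weight n b b' ((norm x)\<^sup>2)) else 0)"
proof -
  define X Y A B N c c' where "X = x $ 1" and "Y = x $ 2" and "A = Re (to_complex x ^ n)"
    and "B = Im (to_complex x ^ n)" and "N = real (Suc n)" and "c = b ((norm x)\<^sup>2)" and "c' = b' ((norm x)\<^sup>2)"
  have z: "Re (to_complex x) = X" "Im (to_complex x) = Y" by (simp_all add: to_complex_def X_def Y_def)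
  have s: "(norm x)\<^sup>2 = X * X + Y * Y"
    by (simp add: power2_norm_eq_inner inner_vec_def sum_2 X_def Y_def)
  have "A * A + B * B = (cmod (to_complex x ^ n))\<^sup>2"
    by (simp only: cmod_power2) (simp add: A_def B_def power2_eq_square)
  also have "\<dots> = ((cmod (to_complex x))\<^sup>2) ^ n"
    by (simp add: norm_power mult.commute flip: power_mult)
  also have "(cmod (to_complex x))\<^sup>2 = (norm x)\<^sup>2"
    by (simp only: cmod_power2 z s) (simp add: power2_eq_square)
  finally have S: "((norm x)\<^sup>2) ^ n = A * A + B * B" by simp
  have u: "stream_field n b b' 1 x $ 1 = 2 * c' * Y * (X * A - Y * B) - N * c * B"
      "stream_field n b b' 1 x $ 2 = - (2 * c' * X * (X * A - Y * B) + N * c * A)"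
      "stream_field n b b' (- \<i>) x $ 1 = 2 * c' * Y * (X * B + Y * A) + N * c * A"
      "stream_field n b b' (- \<i>) x $ 2 = - (2 * c' * X * (X * B + Y * A) + N * c * B)"
    by (simp_all add: stream_field_nth z flip: X_def Y_def A_def B_def N_def c_def c'_def del: of_nat_Suc)
  have g: "radial_weight n b b' ((norm x)\<^sup>2) = - (4 * (A * A + B * B) * c' * ((X * X + Y * Y) * c' + N * c))"
    by (simp add: radial_weight_def S flip: N_def c_def c'_def del: of_nat_Suc) (simp add: s)
  have ij: "i = 1 \<or> i = 2" "j = 1 \<or> j = 2" using exhaust_2 by auto
  show ?thesis
    unfolding g S N_def[symmetric] c_def[symmetric] unfolding s
    using ij
    by (elim disjE) (simp_all add: u power2_eq_square algebra_simps flip: X_def Y_def)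
qed

section \<open>Contradiction to the extension condition\<close>

lemma has_weak_grad_smooth:
  fixes f :: "real^'n \<Rightarrow> real^'m"
  assumes "open \<Omega>" "bounded \<Omega>" "smooth f"
  shows "has_weak_grad \<Omega> f (\<lambda>x. matrix (frechet_derivative f (at x)))"
  by (intro has_weak_grad_classical smooth_C1 assms) (simp add: axis_in_Basis_iff)

lemma test_function_W12_0:
  fixes f :: "real^'n \<Rightarrow> real^'m"
  assumes \<Omega>: "open \<Omega>" "bounded \<Omega>" and f: "f \<in> test_functions \<Omega>"
  shows "f \<in> W12_0 \<Omega>"
proof -
  have "smooth f" using f by (simp add: test_functions_def)
  note G = has_weak_grad_smooth[OF \<Omega> this]
  have "AE x in lebesgue_on \<Omega>. weak_grad \<Omega> (\<lambda>x. f x - f x) x = 0"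
    using weak_grad_AE_eq[OF \<Omega> has_weak_grad_diff[OF \<Omega> G G]] by simp
  then have "(\<integral>x. (norm (weak_grad \<Omega> (\<lambda>x. f x - f x) x))\<^sup>2 \<partial>lebesgue_on \<Omega>) = 0"
    by (intro integral_eq_zero_AE) (auto elim!: eventually_mono)
  then have "W12_norm \<Omega> (\<lambda>x. f x - f x) = 0"
    by (simp add: W12_norm_def l2_norm_def)
  then show ?thesis
    using f G by (auto simp: W12_0_def W12_def intro!: exI[of _ "\<lambda>_. f"])
qed

lemma compact_norm_power2_shell: "compact {x::'a::euclidean_space. l \<le> (norm x)\<^sup>2 \<and> (norm x)\<^sup>2 \<le> r}"
proof -
  have "closed {x::'a. l \<le> (norm x)\<^sup>2 \<and> (norm x)\<^sup>2 \<le> r}"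
    by (intro closed_Collect_conj closed_Collect_le continuous_intros)
  moreover have "norm x \<le> sqrt r" if "(norm x)\<^sup>2 \<le> r" for x :: 'a
    using that by (rule real_le_rsqrt)
  then have "bounded {x::'a. l \<le> (norm x)\<^sup>2 \<and> (norm x)\<^sup>2 \<le> r}"
    by (intro bounded_subset[OF bounded_cball[of 0 "sqrt r"]]) auto
  ultimately show ?thesis by (simp add: compact_eq_bounded_closed)
qed

lemma norm_power2_shell_subset_annulus:
  assumes "0 < R1" "R1 < R2" "R1\<^sup>2 < l" "r < R2\<^sup>2"
  shows "{x. l \<le> (norm x)\<^sup>2 \<and> (norm x)\<^sup>2 \<le> r} \<subseteq> annulus R1 R2"
proof
  fix x :: "real^2" assume "x \<in> {x. l \<le> (norm x)\<^sup>2 \<and> (norm x)\<^sup>2 \<le> r}"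
  then have "R1\<^sup>2 < (norm x)\<^sup>2" "(norm x)\<^sup>2 < R2\<^sup>2" using assms by auto
  then show "x \<in> annulus R1 R2"
    using assms by (auto simp: annulus_def intro: power_less_imp_less_base)
qed

text \<open>
  The multiple of the identity contributes \<open>\<kappa> div V = 0\<close>. The functions \<open>g(|x|\<^sup>2) x\<^sub>i x\<^sub>j\<close> are test
  functions, so the rest is integrated by parts with the weak gradient of \<open>V\<close>, where
  \<open>\<Sum>\<^sub>j \<partial>\<^sub>j (g(s) x\<^sub>i x\<^sub>j) = (2 s g'(s) + 3 g(s)) x\<^sub>i\<close> in two dimensions with \<open>s = |x|\<^sup>2\<close>.
\<close>
lemma integral_convective_quadratic:
  fixes V :: "real^2 \<Rightarrow> real^2" and g g' :: "real \<Rightarrow> real"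
  assumes V: "V \<in> W12 (annulus R1 R2)" "solenoidal (annulus R1 R2) V"
    and R: "0 < R1" "R1 < R2" "R1\<^sup>2 < l" "r < R2\<^sup>2"
    and g: "g \<in> elementary" "\<And>s. (g has_real_derivative g' s) (at s)" "\<And>s. s \<notin> {l..r} \<Longrightarrow> g s = 0"
    and U: "\<And>k. k \<in> I \<Longrightarrow> continuous_on UNIV (U k)"
    and UU: "\<And>x i j. (\<Sum>k\<in>I. U k x $ i * U k x $ j) = g ((norm x)\<^sup>2) * x $ i * x $ j + (if i = j then \<kappa> x else 0)"
  shows "(\<Sum>k\<in>I. convective_form (annulus R1 R2) (U k) V (U k))
    = - (\<integral>x. V x \<bullet> ((2 * (norm x)\<^sup>2 * g' ((norm x)\<^sup>2) + 3 * g ((norm x)\<^sup>2)) *\<^sub>R x) \<partial>lebesgue_on (annulus R1 R2))"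
proof -
  let ?\<Omega> = "annulus R1 R2" and ?s = "\<lambda>x::real^2. (norm x)\<^sup>2"
  note \<Omega> = open_annulus[of R1 R2] bounded_annulus[of R1 R2]
  define G where "G = weak_grad ?\<Omega> V"
  define \<phi> :: "2 \<Rightarrow> 2 \<Rightarrow> real^2 \<Rightarrow> real" where "\<phi> = (\<lambda>i j x. g (?s x) * x $ i * x $ j)"
  have VG: "has_weak_grad ?\<Omega> V G"
    unfolding G_def by (rule has_weak_grad_weak_grad[OF V(1)])
  have trG: "AE x in lebesgue_on ?\<Omega>. (\<Sum>i\<in>UNIV. G x $ i $ i) = 0"
    using V(2) by (simp add: solenoidal_def G_def)
  have Gi: "integrable (lebesgue_on ?\<Omega>) (\<lambda>x. G x $ i $ j)" and Vi: "integrable (lebesgue_on ?\<Omega>) (\<lambda>x. V x $ i)" for i j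
    using VG by (auto simp: has_weak_grad_def intro: square_integrable_component_integrable[OF \<Omega>])
  have \<phi>_elem: "\<phi> i j \<in> elementary" for i j
    unfolding \<phi>_def
    by (intro elementary.mult elementary_nth elementary_compose[OF g(1) elementary_norm_power2])
  have \<phi>_test: "\<phi> i j \<in> test_functions ?\<Omega>" for i j
    by (rule smooth_test_function[OF elementary_smooth_real[OF \<phi>_elem] compact_norm_power2_shell norm_power2_shell_subset_annulus[OF R]])
       (auto simp: \<phi>_def g(3))
  have \<phi>_der: "frechet_derivative (\<phi> i j) (at x) (axis j 1)
      = g (?s x) * (x $ i + (if i = j then x $ j else 0)) + 2 * g' (?s x) * x $ i * (x $ j)\<^sup>2" for i j x
  proof -
    have sq: "((\<lambda>x::real^2. (norm x)\<^sup>2) has_derivative (\<lambda>h. 2 * (x \<bullet> h))) (at x)"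
      unfolding power2_norm_eq_inner by (auto intro!: derivative_eq_intros simp: inner_commute)
    have nth: "((\<lambda>x::real^2. x $ i) has_derivative (\<lambda>h. h $ i)) (at x)" for i
      using bounded_linear_imp_has_derivative[OF bounded_linear_vec_nth] .
    have "(\<phi> i j has_derivative (\<lambda>h. g (?s x) * x $ i * h $ j
        + (g (?s x) * h $ i + 2 * (x \<bullet> h) * g' (?s x) * x $ i) * x $ j)) (at x)"
      unfolding \<phi>_def
      by (intro has_derivative_mult nth DERIV_compose_FDERIV[OF g(2) sq])
    from frechet_derivative_at[OF this, symmetric] show ?thesis
      by (simp only: inner_axis) (simp add: axis_def power2_eq_square algebra_simps)
  qed
  have U2: "integrable (lebesgue_on ?\<Omega>) (\<lambda>x. U k x $ j * G x $ i $ j * U k x $ i)" if "k \<in> I" for k i j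
  proof -
    have "integrable (lebesgue_on ?\<Omega>) (\<lambda>x. G x $ i $ j * (U k x $ j * U k x $ i))"
      using Gi by (intro integrable_mult_continuous \<Omega>)
        (auto intro!: continuous_intros continuous_on_subset[OF U[OF that]])
    then show ?thesis by (simp add: mult_ac)
  qed
  have G\<phi>: "integrable (lebesgue_on ?\<Omega>) (\<lambda>x. G x $ i $ j * \<phi> i j x)" for i j
    using Gi by (intro integrable_mult_continuous \<Omega> elementary_continuous \<phi>_elem)
  have V\<phi>: "integrable (lebesgue_on ?\<Omega>) (\<lambda>x. V x $ i * frechet_derivative (\<phi> i j) (at x) (axis j 1))" for i j
    using Vi test_function_C1(2)[OF \<phi>_test, of "axis j 1" i j]
    by (intro integrable_mult_continuous \<Omega>) (auto simp: axis_in_Basis_iff intro: continuous_on_subset)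
  have "(\<Sum>k\<in>I. convective_form ?\<Omega> (U k) V (U k))
      = (\<integral>x. (\<Sum>k\<in>I. \<Sum>i\<in>UNIV. \<Sum>j\<in>UNIV. U k x $ j * G x $ i $ j * U k x $ i) \<partial>lebesgue_on ?\<Omega>)"
    unfolding convective_form_def G_def[symmetric]
    by (intro Bochner_Integration.integral_sum[symmetric] Bochner_Integration.integrable_sum U2)
  also have "\<dots> = (\<integral>x. (\<Sum>i\<in>UNIV. \<Sum>j\<in>UNIV. G x $ i $ j * \<phi> i j x) \<partial>lebesgue_on ?\<Omega>)"
  proof (rule integral_cong_AE)
    show "AE x in lebesgue_on ?\<Omega>. (\<Sum>k\<in>I. \<Sum>i\<in>UNIV. \<Sum>j\<in>UNIV. U k x $ j * G x $ i $ j * U k x $ i)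
        = (\<Sum>i\<in>UNIV. \<Sum>j\<in>UNIV. G x $ i $ j * \<phi> i j x)"
      using trG
    proof eventually_elim
      case (elim x)
      have "(\<Sum>k\<in>I. \<Sum>i\<in>UNIV. \<Sum>j\<in>UNIV. U k x $ j * G x $ i $ j * U k x $ i)
          = (\<Sum>i\<in>UNIV. \<Sum>j\<in>UNIV. \<Sum>k\<in>I. U k x $ j * G x $ i $ j * U k x $ i)"
        by (subst sum.swap, intro sum.cong refl sum.swap)
      also have "\<dots> = (\<Sum>i\<in>UNIV. \<Sum>j\<in>UNIV. G x $ i $ j * (\<Sum>k\<in>I. U k x $ i * U k x $ j))"
        unfolding sum_distrib_left by (intro sum.cong refl) (simp add: mult_ac)
      also have "\<dots> = (\<Sum>i\<in>UNIV. \<Sum>j\<in>UNIV. G x $ i $ j * \<phi> i j x)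
          + (\<Sum>i\<in>UNIV. \<Sum>j\<in>UNIV. G x $ i $ j * (if i = j then \<kappa> x else 0))"
        unfolding UU distrib_left sum.distrib \<phi>_def ..
      also have "(\<Sum>i\<in>UNIV. \<Sum>j\<in>UNIV. G x $ i $ j * (if i = j then \<kappa> x else 0)) = (\<Sum>i\<in>UNIV. G x $ i $ i) * \<kappa> x"
        by (simp add: if_distrib sum_distrib_right cong: if_cong)
      finally show ?case using elim by simp
    qed
    show "(\<lambda>x. \<Sum>k\<in>I. \<Sum>i\<in>UNIV. \<Sum>j\<in>UNIV. U k x $ j * G x $ i $ j * U k x $ i) \<in> borel_measurable (lebesgue_on ?\<Omega>)"
      by (intro borel_measurable_sum borel_measurable_integrable[OF U2])
    show "(\<lambda>x. \<Sum>i\<in>UNIV. \<Sum>j\<in>UNIV. G x $ i $ j * \<phi> i j x) \<in> borel_measurable (lebesgue_on ?\<Omega>)"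
      by (intro borel_measurable_sum borel_measurable_integrable[OF G\<phi>])
  qed
  also have "\<dots> = (\<Sum>i\<in>UNIV. \<Sum>j\<in>UNIV. \<integral>x. G x $ i $ j * \<phi> i j x \<partial>lebesgue_on ?\<Omega>)"
    by (simp only: Bochner_Integration.integral_sum Bochner_Integration.integrable_sum G\<phi>)
  also have "\<dots> = - (\<Sum>i\<in>UNIV. \<Sum>j\<in>UNIV. \<integral>x. V x $ i * frechet_derivative (\<phi> i j) (at x) (axis j 1) \<partial>lebesgue_on ?\<Omega>)"
    using VG \<phi>_test by (simp add: has_weak_grad_def sum_negf)
  also have "(\<Sum>i\<in>UNIV. \<Sum>j\<in>UNIV. \<integral>x. V x $ i * frechet_derivative (\<phi> i j) (at x) (axis j 1) \<partial>lebesgue_on ?\<Omega>)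
      = (\<integral>x. (\<Sum>i\<in>UNIV. \<Sum>j\<in>UNIV. V x $ i * frechet_derivative (\<phi> i j) (at x) (axis j 1)) \<partial>lebesgue_on ?\<Omega>)"
    by (simp only: Bochner_Integration.integral_sum Bochner_Integration.integrable_sum V\<phi>)
  also have "(\<lambda>x. \<Sum>i\<in>UNIV. \<Sum>j\<in>UNIV. V x $ i * frechet_derivative (\<phi> i j) (at x) (axis j 1))
      = (\<lambda>x. V x \<bullet> ((2 * ?s x * g' (?s x) + 3 * g (?s x)) *\<^sub>R x))"
  proof
    fix x
    have s: "?s x = (x $ 1)\<^sup>2 + (x $ 2)\<^sup>2"
      by (simp only: power2_norm_eq_inner) (simp add: inner_vec_def sum_2 power2_eq_square)
    have "(\<Sum>i\<in>UNIV. \<Sum>j\<in>UNIV. V x $ i * frechet_derivative (\<phi> i j) (at x) (axis j 1))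
        = (3 * g (?s x) + 2 * g' (?s x) * ((x $ 1)\<^sup>2 + (x $ 2)\<^sup>2)) * (V x $ 1 * x $ 1 + V x $ 2 * x $ 2)"
      unfolding \<phi>_der sum_2 by (simp add: algebra_simps)
    also have "\<dots> = V x \<bullet> ((2 * ?s x * g' (?s x) + 3 * g (?s x)) *\<^sub>R x)"
      unfolding s[symmetric] by (simp add: inner_vec_def sum_2 algebra_simps)
    finally show "(\<Sum>i\<in>UNIV. \<Sum>j\<in>UNIV. V x $ i * frechet_derivative (\<phi> i j) (at x) (axis j 1))
        = V x \<bullet> ((2 * ?s x * g' (?s x) + 3 * g (?s x)) *\<^sub>R x)" .
  qed
  finally show ?thesis .
qed

text \<open>
  The potential is \<open>H = s g(s) + (1/2) \<integral> g\<close> with \<open>s = |x|\<^sup>2\<close>. On the two circles \<open>g\<close> vanishes, so only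
  the integral counts there. The antiderivative is taken from \<open>0\<close> and thus differentiable only for \<open>s > 0\<close>.
\<close>
lemma radial_potential:
  fixes g g' :: "real \<Rightarrow> real"
  assumes R: "0 < R1" "R1 < R2"
    and g: "\<And>s. (g has_real_derivative g' s) (at s)" "g (R1\<^sup>2) = 0" "g (R2\<^sup>2) = 0"
  obtains H :: "real^2 \<Rightarrow> real" where
    "\<And>x. x \<noteq> 0 \<Longrightarrow> (H has_derivative (\<lambda>h. ((2 * (norm x)\<^sup>2 * g' ((norm x)\<^sup>2) + 3 * g ((norm x)\<^sup>2)) *\<^sub>R x) \<bullet> h)) (at x)"
    "\<And>x. norm x = R1 \<Longrightarrow> H x = 0" "\<And>x. norm x = R2 \<Longrightarrow> H x = integral {R1\<^sup>2..R2\<^sup>2} g / 2"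
proof -
  define \<Gamma> where "\<Gamma> = (\<lambda>s. integral {0..s} g)"
  define H :: "real^2 \<Rightarrow> real" where
    "H = (\<lambda>x. (norm x)\<^sup>2 * g ((norm x)\<^sup>2) + (\<Gamma> ((norm x)\<^sup>2) - \<Gamma> (R1\<^sup>2)) / 2)"
  have gc: "continuous_on S g" for S
    using g(1) by (meson DERIV_continuous continuous_at_imp_continuous_on)
  have \<Gamma>: "(\<Gamma> has_real_derivative g s) (at s)" if "0 < s" for s
  proof -
    have "(\<Gamma> has_real_derivative g s) (at s within {0..s + 1})"
      unfolding \<Gamma>_def using that by (intro integral_has_real_derivative gc) auto
    moreover have "at s within {0..s + 1} = at s"
      using that by (intro at_within_interior) auto
    ultimately show ?thesis by simp
  qed
  have "(H has_derivative (\<lambda>h. ((2 * (norm x)\<^sup>2 * g' ((norm x)\<^sup>2) + 3 * g ((norm x)\<^sup>2)) *\<^sub>R x) \<bullet> h)) (at x)"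
    if "x \<noteq> 0" for x
  proof -
    have sq: "((\<lambda>x::real^2. (norm x)\<^sup>2) has_derivative (\<lambda>h. 2 * (x \<bullet> h))) (at x)"
      unfolding power2_norm_eq_inner by (auto intro!: derivative_eq_intros simp: inner_commute)
    define s where "s = (norm x)\<^sup>2"
    have s: "0 < s" using that by (simp add: s_def)
    have "((\<lambda>s. s * g s + (\<Gamma> s - \<Gamma> (R1\<^sup>2)) / 2) has_real_derivative s * g' s + 3 / 2 * g s) (at s)"
      by (auto intro!: derivative_eq_intros g(1) \<Gamma> s)
    from DERIV_compose_FDERIV[OF this[unfolded s_def] sq] show ?thesis
      unfolding H_def by (rule has_derivative_eq_rhs) (simp add: fun_eq_iff algebra_simps)
  qed
  moreover have "H x = 0" if "norm x = R1" for x using that g by (simp add: H_def)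
  moreover have "H x = integral {R1\<^sup>2..R2\<^sup>2} g / 2" if "norm x = R2" for x
  proof -
    have "R1\<^sup>2 \<le> R2\<^sup>2" using R by (intro power_mono) auto
    then have "\<Gamma> (R1\<^sup>2) + integral {R1\<^sup>2..R2\<^sup>2} g = \<Gamma> (R2\<^sup>2)"
      unfolding \<Gamma>_def
      by (intro Henstock_Kurzweil_Integration.integral_combine integrable_continuous_real gc) auto
    then show ?thesis using that g by (simp add: H_def)
  qed
  ultimately show thesis by (rule that)
qed

theorem mainTheorem2:
  fixes R1 R2 \<Phi> :: real and v :: "real ^ 2 \<Rightarrow> real ^ 2"
  assumes "0 < R1" and "R1 < R2"
    and "v \<in> W_half_boundary R1 R2"
    and "\<Phi> = (\<integral>x. v x \<bullet> outer_normal R1 R2 x \<partial>circle_measure R2)"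
    and "\<Phi> = - (\<integral>x. v x \<bullet> outer_normal R1 R2 x \<partial>circle_measure R1)"
    and "\<Phi> > 0"
  shows "\<not> leray_hopf_extension_condition R1 R2 v"
proof
  assume ext: "leray_hopf_extension_condition R1 R2 v"
  let ?\<Omega> = "annulus R1 R2"
  note R = assms(1,2) and \<Omega> = open_annulus[of R1 R2] bounded_annulus[of R1 R2]
  have "0 < R1\<^sup>2" "R1\<^sup>2 < R2\<^sup>2" using R by (auto intro: power_strict_mono)
  then obtain b b' :: "real \<Rightarrow> real" and l r n where
    b: "b \<in> elementary" "b' \<in> elementary" "\<And>s. (b has_real_derivative b' s) (at s)"
    and lr: "R1\<^sup>2 < l" "r < R2\<^sup>2" and supp: "\<And>s. s \<notin> {l..r} \<Longrightarrow> b s = 0 \<and> b' s = 0"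
    and pos: "0 < integral {R1\<^sup>2..R2\<^sup>2} (radial_weight n b b')"
    by (rule exists_radial_profile) blast
  define g where "g = radial_weight n b b'"
  define c where "c = integral {R1\<^sup>2..R2\<^sup>2} g / 2"
  have c: "0 < c" using pos by (simp add: c_def g_def)
  have g: "g \<in> elementary"
    unfolding g_def radial_weight_def
    by (intro elementary_minus elementary.mult elementary.add elementary.const elementary_power elementary_id b)
  obtain g' where g': "g' \<in> elementary" "\<And>s. (g has_real_derivative g' s) (at s)"
    using elementary_real_derivative[OF g] by blast
  have g0: "g s = 0" if "s \<notin> {l..r}" for s
    using supp[OF that] by (simp add: g_def radial_weight_def)
  define X :: "real^2 \<Rightarrow> real^2" where
    "X = (\<lambda>x. (2 * (norm x)\<^sup>2 * g' ((norm x)\<^sup>2) + 3 * g ((norm x)\<^sup>2)) *\<^sub>R x)"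
  obtain H where H: "\<And>x. x \<noteq> 0 \<Longrightarrow> (H has_derivative (\<lambda>h. X x \<bullet> h)) (at x)"
    "\<And>x. norm x = R1 \<Longrightarrow> H x = 0" "\<And>x. norm x = R2 \<Longrightarrow> H x = c"
    unfolding X_def c_def
    by (rule radial_potential[OF R g'(2)]) (use g0 lr in auto)
  have X_cont: "continuous_on (closed_annulus R1 R2) X"
    unfolding X_def
    by (intro continuous_intros continuous_on_compose2[OF elementary_continuous[OF g(1), of UNIV]]
        continuous_on_compose2[OF elementary_continuous[OF g'(1), of UNIV]]) auto
  define u where "u = stream_field n b b'"
  have u_elem: "(\<lambda>x. u w x $ i) \<in> elementary" for w i
    unfolding u_def by (rule elementary_stream_field[OF b(1,2)])
  have u_test: "u w \<in> test_functions ?\<Omega>" for w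
  proof (rule smooth_test_function[OF elementary_smooth[OF u_elem] compact_norm_power2_shell
        norm_power2_shell_subset_annulus[OF R lr]])
    fix x :: "real^2" assume "x \<notin> {x. l \<le> (norm x)\<^sup>2 \<and> (norm x)\<^sup>2 \<le> r}"
    then have "(norm x)\<^sup>2 \<notin> {l..r}" by auto
    from supp[OF this] show "u w x = 0"
      by (simp add: u_def vec_eq_iff forall_2 stream_field_nth del: power_Suc)
  qed
  have u_smooth: "smooth (u w)" for w
    using u_test[of w] by (simp add: test_functions_def)
  have u_sol: "solenoidal ?\<Omega> (u w)" for w
  proof -
    have "(\<Sum>i\<in>UNIV. frechet_derivative (u w) (at x) (axis i 1) $ i) = 0" for x
      using smooth_C1(1)[OF u_smooth] unfolding u_def by (rule stream_field_divergence[OF b])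
    with weak_grad_AE_eq[OF \<Omega> has_weak_grad_smooth[OF \<Omega> u_smooth[of w]]] show ?thesis
      unfolding solenoidal_def by (auto simp: matrix_def elim!: eventually_mono)
  qed
  define E where "E = (\<lambda>w. (l2_norm (lebesgue_on ?\<Omega>) (weak_grad ?\<Omega> (u w)))\<^sup>2)"
  define C where "C = E 1 + E (- \<i>)"
  have "0 \<le> C" by (simp add: C_def E_def)
  have key: "c * \<Phi> \<le> \<epsilon> * C" if \<epsilon>: "0 < \<epsilon>" for \<epsilon>
  proof -
    obtain V where V: "V \<in> W12 ?\<Omega>" "solenoidal ?\<Omega> V" "has_trace R1 R2 V v"
      and le: "\<And>u. u \<in> W12_0 ?\<Omega> \<Longrightarrow> solenoidal ?\<Omega> u \<Longrightarrow> - convective_form ?\<Omega> u V u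
             \<le> \<epsilon> * (l2_norm (lebesgue_on ?\<Omega>) (weak_grad ?\<Omega> u))\<^sup>2"
      using ext \<epsilon> unfolding leray_hopf_extension_condition_def by blast
    have "c * \<Phi> = (\<integral>x. V x \<bullet> X x \<partial>lebesgue_on ?\<Omega>)"
      unfolding assms(4)
    proof (rule integral_radial_gradient[OF R V(2,3) H(1) X_cont H(2,3), symmetric])
      show "x \<noteq> 0" if "x \<in> closed_annulus R1 R2" for x
        using that R by (auto simp: closed_annulus_def)
    qed auto
    also have "\<dots> = - (\<Sum>w\<in>{1, - \<i>}. convective_form ?\<Omega> (u w) V (u w))"
    proof -
      have "(\<Sum>w\<in>{1, - \<i>}. u w x $ i * u w x $ j) = g ((norm x)\<^sup>2) * x $ i * x $ j
          + (if i = j then (real (Suc n) * b ((norm x)\<^sup>2))\<^sup>2 * ((norm x)\<^sup>2) ^ n - (norm x)\<^sup>2 * g ((norm x)\<^sup>2) else 0)" for x i j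
        using stream_field_products[of n b b' x i j] by (simp add: u_def g_def complex_eq_iff)
      from integral_convective_quadratic[OF V(1,2) R lr g g'(2) g0 smooth_C1(3)[OF u_smooth] this]
      show ?thesis by (simp add: X_def)
    qed
    also have "\<dots> = - convective_form ?\<Omega> (u 1) V (u 1) + - convective_form ?\<Omega> (u (- \<i>)) V (u (- \<i>))"
      by (simp add: complex_eq_iff)
    also have "\<dots> \<le> \<epsilon> * E 1 + \<epsilon> * E (- \<i>)"
      unfolding E_def by (intro add_mono le test_function_W12_0 \<Omega> u_test u_sol)
    finally show ?thesis by (simp add: C_def distrib_left)
  qed
  \<comment> \<open>any \<open>\<epsilon>\<close> with \<open>\<epsilon> C < c \<Phi>\<close> gives a contradiction\<close>
  have "c * \<Phi> \<le> c * \<Phi> / (2 * (C + 1)) * C"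
    by (rule key) (use c assms(6) \<open>0 \<le> C\<close> in auto)
  also have "\<dots> = c * \<Phi> / 2 * (C / (C + 1))" using \<open>0 \<le> C\<close> by (simp add: field_simps)
  also have "\<dots> \<le> c * \<Phi> / 2 * 1"
    using c assms(6) \<open>0 \<le> C\<close> by (intro mult_left_mono) auto
  finally show False using mult_pos_pos[OF c assms(6)] by linarith
qed

end
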